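(* Let $k$ and $\ell$ be integers with $k\ge 3$, $\ell\ge 2(k-1)^2$ and $k\nmid \ell$. Let $d$ be the smallest integer greater than $2$ that divides $k$ but does not divide $\ell$. If $2\nmid k$, or $2\mid \ell$, or $d\le 4$, then $$\mathrm{ex}(n,\overrightarrow{C}_k,\overrightarrow{C}_\ell)=\frac{n}{k}\left(\frac{n}{d}\right)^{k-1}+o(n^k).$$
   Context: An oriented graph is a directed graph without loops in which every pair of vertices is joined by at most one arc. $\overrightarrow{C}_m$ denotes the directed cycle of length $m$. A copy of $H$ in $G$ is a (not necessarily induced) subgraph of $G$ isomorphic to $H$. $\mathrm{ex}(n,\overrightarrow{C}_k,\overrightarrow{C}_\ell)$ is the maximum number of copies of $\overrightarrow{C}_k$ in an $n$-vertex oriented graph containing no copy of $\overrightarrow{C}_\ell$. Asymptotics are as $n\to\infty$ with $k,\ell$ fixed. *)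

theory Defs
  imports
    Complex_Main
    "HOL-Library.Landau_Symbols"
    "Graph_Theory.Digraph_Component"
    "Graph_Theory.Digraph_Isomorphism"
begin

locale oriented_graph = pair_digraph G for G :: "'a pair_pre_digraph" +
  assumes at_most_one_arc: "(u, v) \<in> parcs G \<Longrightarrow> (v, u) \<notin> parcs G"

definition directed_cycle :: "nat \<Rightarrow> nat pair_pre_digraph" where
  "directed_cycle m =
     \<lparr> pverts = {..<m}, parcs = {(i, (i + 1) mod m) | i. i < m} \<rparr>"

definition copies :: "'b pair_pre_digraph \<Rightarrow> 'a pair_pre_digraph \<Rightarrow> 'a pair_pre_digraph set" where
  "copies H G = {S. subgraph (with_proj S) (with_proj G) \<and> digraph_iso (with_proj S) (with_proj H)}"

text \<open>
  Every finite graph is isomorphic to one with vertices in \<^typ>\<open>nat\<close>, so it suffices to let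
  \<open>G\<close> range over those. The maximum is over a finite set by \<open>finite_copy_counts\<close>, and for
  \<open>F = directed_cycle l\<close> with \<open>l > 0\<close> over a nonempty one by \<open>copy_counts_nonempty\<close>.
\<close>
definition copy_counts :: "nat \<Rightarrow> 'b pair_pre_digraph \<Rightarrow> 'c pair_pre_digraph \<Rightarrow> nat set" where
  "copy_counts n H F =
     {card (copies H G) | G :: nat pair_pre_digraph.
        oriented_graph G \<and> card (pverts G) = n \<and> copies F G = {}}"

definition ex_copies :: "nat \<Rightarrow> 'b pair_pre_digraph \<Rightarrow> 'c pair_pre_digraph \<Rightarrow> nat" where
  "ex_copies n H F = Max (copy_counts n H F)"

lemma copies_subset:
  "copies H G \<subseteq> (\<lambda>(V, A). \<lparr>pverts = V, parcs = A\<rparr>) ` (Pow (pverts G) \<times> Pow (parcs G))"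
proof
  fix S assume "S \<in> copies H G"
  then have "pverts S \<subseteq> pverts G" "parcs S \<subseteq> parcs G"
    by (auto simp: copies_def subgraph_def)
  then show "S \<in> (\<lambda>(V, A). \<lparr>pverts = V, parcs = A\<rparr>) ` (Pow (pverts G) \<times> Pow (parcs G))"
    by (intro image_eqI[of _ _ "(pverts S, parcs S)"]) auto
qed

lemma finite_copies:
  assumes "oriented_graph G"
  shows "finite (copies H G)"
proof -
  interpret oriented_graph G by fact
  show ?thesis
    by (rule finite_subset[OF copies_subset]) (simp add: pair_finite_verts pair_finite_arcs)
qed

lemma finite_copy_counts: "finite (copy_counts n H F)"
proof -
  have "card (copies H G) \<le> 2 ^ n * 2 ^ (n * n)"
    if G: "oriented_graph G" "card (pverts G) = n" for G :: "nat pair_pre_digraph"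
  proof -
    interpret oriented_graph G by fact
    have "parcs G \<subseteq> pverts G \<times> pverts G"
      by (auto dest: in_arcsD1 in_arcsD2)
    then have arcs: "card (parcs G) \<le> n * n"
      using card_mono[of "pverts G \<times> pverts G" "parcs G"] G(2) pair_finite_verts
      by (simp add: card_cartesian_product)
    have fin: "finite (Pow (pverts G) \<times> Pow (parcs G))"
      by (simp add: pair_finite_verts pair_finite_arcs)
    have "card (copies H G) \<le> card (Pow (pverts G) \<times> Pow (parcs G))"
      using fin by (rule surj_card_le[OF _ copies_subset])
    also have "\<dots> = 2 ^ n * 2 ^ card (parcs G)"
      by (simp add: card_cartesian_product card_Pow pair_finite_verts pair_finite_arcs G(2))
    also have "\<dots> \<le> 2 ^ n * 2 ^ (n * n)"
      using arcs by simp
    finally show ?thesis .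
  qed
  then have "copy_counts n H F \<subseteq> {..2 ^ n * 2 ^ (n * n)}"
    by (auto simp: copy_counts_def)
  then show ?thesis
    by (rule finite_subset) simp
qed

lemma copy_counts_nonempty:
  assumes "l > 0"
  shows "copy_counts n H (directed_cycle l) \<noteq> {}"
proof -
  let ?G = "\<lparr>pverts = {..<n}, parcs = {}\<rparr> :: nat pair_pre_digraph"
  have "oriented_graph ?G"
    by unfold_locales auto
  moreover have "copies (directed_cycle l) ?G = {}"
  proof -
    have "parcs S \<noteq> {}" if "digraph_iso (with_proj S) (with_proj (directed_cycle l))"
      for S :: "nat pair_pre_digraph"
    proof
      assume "parcs S = {}"
      from that obtain f where "with_proj (directed_cycle l) = app_iso f (with_proj S)"
        by (auto simp: digraph_iso_def)
      from arg_cong[OF this, of arcs] have "parcs (directed_cycle l) = {}"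
        using \<open>parcs S = {}\<close> by simp
      then show False
        using assms by (auto simp: directed_cycle_def)
    qed
    then show ?thesis
      by (auto simp: copies_def subgraph_def)
  qed
  ultimately have "card (copies H ?G) \<in> copy_counts n H (directed_cycle l)"
    unfolding copy_counts_def by (intro CollectI exI[of _ ?G]) simp
  then show ?thesis
    by blast
qed

end

theory Submission
  imports Defs "HOL-Library.FuncSet" "HOL-Analysis.Convex"
begin

text \<open>
  The lower bound is attained by the balanced blow-up of the directed cycle of length \<open>d\<close>.

  For the upper bound, suppose first that an oriented graph on \<open>m\<close> vertices has no closed walk of
  length \<open>l\<close> at all, and discard the arcs that lie on no closed walk of length \<open>k\<close>. Relative to a closed
  walk \<open>w\<close> of length \<open>k\<close>, any vertex \<open>u\<close> is joined to \<open>w\<close> by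
  at most \<open>2 k / d\<close> arcs: otherwise the closed walks through \<open>u\<close> and \<open>w\<close> have lengths with a greatest
  common divisor dividing \<open>l\<close>, and \<open>l \<ge> 2 (k - 1)\<^sup>2\<close> is enough to combine them into one of length \<open>l\<close>. So
  the in- and outdegrees along \<open>w\<close> have geometric mean at most \<open>m / d\<close>. A random walk from a random start,
  run forwards or backwards, then traces \<open>w\<close> with average probability at least
  \<open>(d / m) ^ (k - 1) / m\<close>, which bounds the number of such \<open>w\<close> by \<open>m (m / d) ^ (k - 1)\<close>.

  A graph without a directed cycle of length \<open>l\<close> may have closed walks of length \<open>l\<close>, but by repeated use of
  Cauchy--Schwarz each pattern of such a walk has density tending to 0. Hence a random sample of \<open>m\<close>
  vertices, for \<open>m\<close> fixed, has none with probability tending to 1, and averaging the previous bound over samples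
  gives the asymptotic bound without a removal lemma.
\<close>

section \<open>Sums of a symmetric set of residues\<close>

text \<open>Sums of exactly \<open>t\<close> elements of \<open>D\<close>, taken up to multiples of
  \<open>k\<close>: the base case is the whole zero class, so every stage is a union of residue
  classes. Integers are used because \<open>D\<close> will consist of differences.\<close>

primrec residue_sums :: "nat \<Rightarrow> int set \<Rightarrow> nat \<Rightarrow> int set" where
  "residue_sums k D 0 = {x. int k dvd x}"
| "residue_sums k D (Suc t) = {x + y | x y. x \<in> residue_sums k D t \<and> y \<in> D}"

lemma residue_sums_SucI:
  "x \<in> residue_sums k D t \<Longrightarrow> y \<in> D \<Longrightarrow> z = x + y \<Longrightarrow> z \<in> residue_sums k D (Suc t)"
  by auto

lemma residue_sums_add:
  assumes "x \<in> residue_sums k D s" "y \<in> residue_sums k D t"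
  shows "x + y \<in> residue_sums k D (s + t)"
  using assms(2)
proof (induction t arbitrary: y)
  case 0
  have "x + y \<in> residue_sums k D s" if "x \<in> residue_sums k D s" "int k dvd y" for x y
    using that
  proof (induction s arbitrary: x)
    case (Suc s)
    then obtain a b where "x = a + b" "a \<in> residue_sums k D s" "b \<in> D" by auto
    moreover from this Suc have "a + y \<in> residue_sums k D s" by blast
    ultimately show ?case
      by (intro residue_sums_SucI[of "a + y" _ _ _ b]) auto
  qed auto
  with 0 assms(1) show ?case by auto
next
  case (Suc t)
  then obtain a b where "y = a + b" "a \<in> residue_sums k D t" "b \<in> D" by auto
  moreover from this Suc have "x + a \<in> residue_sums k D (s + t)" by blast
  ultimately show ?case
    unfolding add_Suc_right by (intro residue_sums_SucI[of "x + a" _ _ _ b]) auto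
qed

lemma residue_sums_uminus:
  assumes "\<And>x. x \<in> D \<Longrightarrow> - x \<in> D" "x \<in> residue_sums k D t"
  shows "- x \<in> residue_sums k D t"
  using assms(2)
proof (induction t arbitrary: x)
  case (Suc t)
  then obtain a b where "x = a + b" "a \<in> residue_sums k D t" "b \<in> D" by auto
  with Suc assms(1) show ?case
    by (intro residue_sums_SucI[of "- a" _ _ _ "- b"]) auto
qed auto

text \<open>Since \<open>0\<close> lies in \<open>D\<close>, a shorter sum can be padded with
  zeros.\<close>

lemma residue_sums_mono:
  assumes "0 \<in> D" "s \<le> t"
  shows "residue_sums k D s \<subseteq> residue_sums k D t"
proof -
  have "residue_sums k D i \<subseteq> residue_sums k D (Suc i)" for i
  proof
    fix x assume "x \<in> residue_sums k D i"
    then show "x \<in> residue_sums k D (Suc i)"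
      using assms(1) by (intro residue_sums_SucI[of x _ _ _ 0]) auto
  qed
  then show ?thesis
    using assms(2) by (rule lift_Suc_mono_le)
qed

lemma residue_sums_mod:
  assumes "x \<in> residue_sums k D t" "int k dvd y - x"
  shows "y \<in> residue_sums k D t"
proof -
  have "x + (y - x) \<in> residue_sums k D (t + 0)"
    by (rule residue_sums_add) (use assms in auto)
  then show ?thesis by simp
qed

text \<open>As long as the sets grow, a symmetric set gains a residue in \<open>{1..k div 2}\<close> at each step.\<close>

lemma residue_sums_stable:
  assumes k: "k > 0" and D0: "0 \<in> D" and sym: "\<And>x. x \<in> D \<Longrightarrow> - x \<in> D"
  shows "residue_sums k D t \<subseteq> residue_sums k D (k div 2)"
proof -
  define X where "X = residue_sums k D"
  define Z where "Z s = {r \<in> {1..k div 2}. int r \<in> X s}" for s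
  have finZ: "finite (Z s)" for s by (simp add: Z_def)
  have grow: "Z s \<subset> Z (Suc s)" if ne: "X (Suc s) \<noteq> X s" for s
  proof -
    have sub: "X s \<subseteq> X (Suc s)"
      unfolding X_def by (rule residue_sums_mono[OF D0]) simp
    then obtain x where x: "x \<in> X (Suc s)" "x \<notin> X s" using ne by blast
    define r where "r = x mod int k"
    have r0: "0 \<le> r" "r < int k" using k by (auto simp: r_def)
    have rX: "r \<in> X (Suc s)"
      using x(1) unfolding X_def by (rule residue_sums_mod) (simp add: r_def mod_eq_dvd_iff[symmetric])
    have rnX: "r \<notin> X s"
      using x(2) residue_sums_mod[of r k D s x] unfolding X_def r_def
      by (metis mod_eq_dvd_iff mod_mod_trivial)
    have neg: "int k - y \<in> X i" if "y \<in> X i" for y i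
    proof -
      have "- y \<in> residue_sums k D i"
        using sym that unfolding X_def by (rule residue_sums_uminus)
      moreover have "int k dvd (int k - y) - (- y)" by simp
      ultimately show ?thesis unfolding X_def by (rule residue_sums_mod)
    qed
    have mX: "int k - r \<in> X (Suc s)" by (rule neg[OF rX])
    have mnX: "int k - r \<notin> X s"
      using neg[of "int k - r" s] rnX by auto
    have "0 \<in> X s"
      using residue_sums_mono[OF D0, of 0 s k] unfolding X_def by auto
    with rnX r0 have "r \<noteq> 0" by auto
    \<comment> \<open>By symmetry \<open>r\<close> and \<open>int k - r\<close> are both new at
      stage \<open>Suc s\<close>, so the smaller of them is a new element of
      \<open>Z (Suc s)\<close>. It is positive because the class of 0 is present at every
      stage.\<close>
    define q where "q = nat (min r (int k - r))"
    have "q \<in> Z (Suc s)" "q \<notin> Z s"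
      using rX rnX mX mnX r0 \<open>r \<noteq> 0\<close> by (auto simp: Z_def q_def min_def)
    moreover have "Z s \<subseteq> Z (Suc s)" using sub by (auto simp: Z_def)
    ultimately show ?thesis by blast
  qed
  \<comment> \<open>Strict growth at every \<open>s\<close> up to \<open>k div 2\<close> would put
    \<open>k div 2 + 1\<close> elements into \<open>{1..k div 2}\<close>.\<close>
  have "\<exists>s\<le>k div 2. X (Suc s) = X s"
  proof (rule ccontr)
    assume "\<not> ?thesis"
    then have ne: "X (Suc s) \<noteq> X s" if "s \<le> k div 2" for s using that by blast
    have "s \<le> Suc (k div 2) \<Longrightarrow> s \<le> card (Z s)" for s
    proof (induction s)
      case (Suc s)
      then have "card (Z s) < card (Z (Suc s))"
        by (intro psubset_card_mono finZ grow ne) auto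
      with Suc show ?case by auto
    qed simp
    from this[of "Suc (k div 2)"] have "Suc (k div 2) \<le> card (Z (Suc (k div 2)))" by simp
    also have "\<dots> \<le> card {1..k div 2}" by (rule card_mono) (auto simp: Z_def)
    finally show False by simp
  qed
  then obtain s where s: "s \<le> k div 2" "X (Suc s) = X s" by blast
  \<comment> \<open>Each stage is computed from the one before alone, so a single repetition freezes
    the sequence.\<close>
  have stab: "X (s + i) = X s" for i
  proof (induction i)
    case (Suc i)
    then show ?case using s(2) by (simp add: X_def)
  qed simp
  have "X t \<subseteq> X (s + t)"
    unfolding X_def by (rule residue_sums_mono[OF D0]) simp
  also have "\<dots> = X s" by (rule stab)
  also have "\<dots> \<subseteq> X (k div 2)" unfolding X_def by (rule residue_sums_mono[OF D0 s(1)])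
  finally show ?thesis by (simp add: X_def)
qed

text \<open>By stability the stage \<open>k div 2\<close> is closed under addition; with negation it
  is a subgroup of the integers, and it contains \<open>k\<close>. Division with remainder shows
  that its least positive element generates it.\<close>

lemma residue_sums_eq_multiples:
  assumes k: "k > 0" and D0: "0 \<in> D" and sym: "\<And>x. x \<in> D \<Longrightarrow> - x \<in> D"
  obtains g where "g dvd k" "residue_sums k D (k div 2) = {x. int g dvd x}"
proof -
  define H where "H = residue_sums k D (k div 2)"
  have add: "x + y \<in> H" if "x \<in> H" "y \<in> H" for x y
    using residue_sums_add[OF that[unfolded H_def]] residue_sums_stable[OF assms] unfolding H_def by blast
  have neg: "- x \<in> H" if "x \<in> H" for x
    using residue_sums_uminus[OF sym that[unfolded H_def]] unfolding H_def .
  have base: "x \<in> H" if "int k dvd x" for x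
    using residue_sums_mono[OF D0, of 0 "k div 2" k] that unfolding H_def by auto
  define g where "g = (LEAST n. n > 0 \<and> int n \<in> H)"
  have g: "g > 0 \<and> int g \<in> H" unfolding g_def
    by (rule LeastI[of _ k]) (use k base in auto)
  have gmin: "g \<le> n" if "n > 0" "int n \<in> H" for n
    unfolding g_def by (rule Least_le) (use that in auto)
  have mulnat: "int g * int n \<in> H" for n
  proof (induction n)
    case (Suc n)
    then show ?case using add[OF Suc conjunct2[OF g]] by (simp add: algebra_simps)
  qed (simp add: base)
  have mul: "int g * z \<in> H" for z
  proof (cases "z \<ge> 0")
    case True
    then show ?thesis using mulnat[of "nat z"] by simp
  next
    case False
    then show ?thesis using neg[OF mulnat[of "nat (- z)"]] by simp
  qed
  have dvd: "int g dvd x" if "x \<in> H" for x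
  proof -
    have "x + int g * (- (x div int g)) \<in> H" by (rule add[OF that mul])
    then have "x mod int g \<in> H" by (simp add: minus_mult_div_eq_mod)
    then have "nat (x mod int g) = 0"
      using gmin[of "nat (x mod int g)"] g
      by (metis bot_nat_0.not_eq_extremum int_nat_eq nat_less_iff not_le of_nat_0_less_iff pos_mod_bound pos_mod_sign)
    then have "x mod int g = 0" using g by (metis eq_nat_nat_iff nat_0 of_nat_0_less_iff order_refl pos_mod_sign)
    then show ?thesis by auto
  qed
  have "H = {x. int g dvd x}"
    using dvd mul by (auto elim!: dvdE)
  moreover have "g dvd k" using dvd[of "int k"] base by simp
  ultimately show ?thesis using that unfolding H_def by blast
qed

section \<open>Closed walks\<close>

text \<open>Walks with a marked start whose vertices may repeat, that is, homomorphisms from the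
  directed cycle of length \<open>k\<close>. Taking extensional functions makes them countable as a
  finite set.\<close>

definition closed_walks :: "nat \<Rightarrow> ('a \<times> 'a) set \<Rightarrow> 'a set \<Rightarrow> (nat \<Rightarrow> 'a) set" where
  "closed_walks k E V = {w \<in> {..<k} \<rightarrow>\<^sub>E V. \<forall>i<k. (w i, w (Suc i mod k)) \<in> E}"

text \<open>Restricting to these arcs loses no closed walk of length \<open>k\<close>, and it gives
  every arc a return path of length \<open>k - 1\<close>, namely the rest of a closed walk through
  it.\<close>

definition walk_arcs :: "nat \<Rightarrow> ('a \<times> 'a) set \<Rightarrow> 'a set \<Rightarrow> ('a \<times> 'a) set" where
  "walk_arcs k E V = {(w i, w (Suc i mod k)) | w i. w \<in> closed_walks k E V \<and> i < k}"

lemma finite_closed_walks: "finite V \<Longrightarrow> finite (closed_walks k E V)"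
  by (simp add: closed_walks_def finite_PiE)

lemma closed_walks_relpow:
  assumes "w \<in> closed_walks k E V" "k > 0"
  shows "(w (i mod k), w ((i + n) mod k)) \<in> E ^^ n"
proof (induction n)
  case (Suc n)
  have "(w ((i + n) mod k), w (Suc ((i + n) mod k) mod k)) \<in> E"
    using assms by (simp add: closed_walks_def)
  then have "(w ((i + n) mod k), w ((i + Suc n) mod k)) \<in> E"
    by (simp add: mod_Suc_eq)
  with Suc show ?case by (rule relpow_Suc_I)
qed simp

lemma walk_arcs_subset: "walk_arcs k E V \<subseteq> E"
  by (auto simp: walk_arcs_def closed_walks_def)

lemma closed_walks_walk_arcs: "closed_walks k (walk_arcs k E V) V = closed_walks k E V"
proof
  show "closed_walks k (walk_arcs k E V) V \<subseteq> closed_walks k E V"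
    using walk_arcs_subset[of k E V] by (auto simp: closed_walks_def)
  show "closed_walks k E V \<subseteq> closed_walks k (walk_arcs k E V) V"
  proof
    fix w assume w: "w \<in> closed_walks k E V"
    then have "(w i, w (Suc i mod k)) \<in> walk_arcs k E V" if "i < k" for i
      using that by (auto simp: walk_arcs_def)
    with w show "w \<in> closed_walks k (walk_arcs k E V) V"
      by (simp add: closed_walks_def)
  qed
qed

lemma walk_arcs_return:
  assumes "k > 0" "(a, b) \<in> walk_arcs k E V"
  shows "(b, a) \<in> walk_arcs k E V ^^ (k - 1)"
proof -
  obtain w i where w: "w \<in> closed_walks k E V" "i < k" "a = w i" "b = w (Suc i mod k)"
    using assms(2) by (auto simp: walk_arcs_def)
  have "w \<in> closed_walks k (walk_arcs k E V) V" using w(1) by (simp add: closed_walks_walk_arcs)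
  from closed_walks_relpow[OF this assms(1), of "Suc i" "k - 1"]
  show ?thesis using w assms(1) by simp
qed

section \<open>Arcs between a vertex and a closed walk\<close>

lemma card_congruent_le:
  assumes "g > 0" "g dvd k" "S \<subseteq> {..<k}"
    and cong: "\<And>i j. i \<in> S \<Longrightarrow> j \<in> S \<Longrightarrow> int g dvd int i - int j"
  shows "g * card S \<le> k"
proof -
  \<comment> \<open>Elements of one class modulo \<open>g\<close> are told apart by their quotients,
    and only \<open>k div g\<close> quotients are possible.\<close>
  have "inj_on (\<lambda>i. i div g) S"
  proof
    fix i j assume "i \<in> S" "j \<in> S" "i div g = j div g"
    moreover from this have "i mod g = j mod g"
      using cong[of i j] by (metis mod_eq_dvd_iff of_nat_eq_iff zmod_int)
    ultimately show "i = j" by (metis div_mult_mod_eq)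
  qed
  moreover have "(\<lambda>i. i div g) ` S \<subseteq> {..<k div g}"
    using assms by (auto simp: div_less_iff_less_mult dvd_div_mult_self)
  ultimately have "card S \<le> k div g"
    using card_inj_on_le[of "\<lambda>i. i div g" S "{..<k div g}"] by simp
  then have "g * card S \<le> g * (k div g)" by simp
  then show ?thesis using assms(2) by simp
qed

text \<open>This is the source of the threshold for \<open>l\<close>: at most \<open>k div 2\<close>
  differences of positions are combined, each realised by a closed walk with at most
  \<open>3 * (k - 1)\<close> steps. Equality holds for \<open>k = 4\<close>.\<close>

lemma length_bound_arith:
  fixes k :: nat
  assumes "k \<ge> 3"
  shows "(k div 2) * (3 * (k - 1)) \<le> 2 * (k - 1)^2"
proof -
  have "3 * (k div 2) \<le> 2 * (k - 1)" using assms by linarith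
  then have "3 * (k div 2) * (k - 1) \<le> 2 * (k - 1) * (k - 1)" by (rule mult_le_mono1)
  then show ?thesis by (simp only: power2_eq_square ac_simps)
qed

text \<open>
  An arc from \<open>w i\<close> to \<open>u\<close> puts \<open>u\<close> in position \<open>i + 1\<close> relative to the closed walk \<open>w\<close>, and an arc from
  \<open>u\<close> to \<open>w i\<close> puts it in position \<open>i - 1\<close>. Any difference of two such positions is, modulo \<open>k\<close>,
  the length of a closed walk through \<open>u\<close> with at most \<open>3 * (k - 1)\<close> steps.
\<close>

lemma closed_walk_adjacency_le:
  assumes k: "k \<ge> 3" and l: "l \<ge> 2 * (k - 1)^2"
    and dmin: "\<And>e. e > 2 \<Longrightarrow> e dvd k \<Longrightarrow> \<not> e dvd l \<Longrightarrow> d \<le> e"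
    and par: "2 dvd k \<Longrightarrow> \<not> 2 dvd l \<Longrightarrow> d \<le> 4"
    and asym: "\<And>a b. (a, b) \<in> F \<Longrightarrow> (b, a) \<notin> F"
    and ret: "\<And>a b. (a, b) \<in> F \<Longrightarrow> (b, a) \<in> F ^^ (k - 1)"
    and no_l: "(u, u) \<notin> F ^^ l"
    and w: "w \<in> closed_walks k F V"
  shows "d * (card {i \<in> {..<k}. (w i, u) \<in> F} + card {i \<in> {..<k}. (u, w i) \<in> F}) \<le> 2 * k"
proof -
  define A where "A = {i \<in> {..<k}. (w i, u) \<in> F}"
  define B where "B = {i \<in> {..<k}. (u, w i) \<in> F}"
  define P where "P = (\<lambda>i. int i + 1) ` A \<union> (\<lambda>i. int i - 1) ` B"
  define D where "D = {q - p | p q. p \<in> P \<and> q \<in> P}"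
  have kpos: "k > 0" using k by simp
  show ?thesis
  proof (cases "P = {}")
    case True
    then have "A = {}" "B = {}" by (auto simp: P_def)
    then show ?thesis unfolding A_def[symmetric] B_def[symmetric] by simp
  next
    case False
    have D0: "0 \<in> D" using False by (force simp: D_def)
    have Dsym: "- x \<in> D" if "x \<in> D" for x
    proof -
      from that obtain p q where "x = q - p" "p \<in> P" "q \<in> P" by (auto simp: D_def)
      then show ?thesis unfolding D_def by (intro CollectI exI[of _ q] exI[of _ p]) auto
    qed
    have uk: "(u, u) \<in> F ^^ k"
    proof -
      have "\<exists>v. (v, u) \<in> F \<or> (u, v) \<in> F" using False by (auto simp: P_def A_def B_def)
      then obtain v where "(v, u) \<in> F \<or> (u, v) \<in> F" ..
      then show ?thesis
      proof
        assume "(v, u) \<in> F"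
        from relpow_Suc_I[OF ret[OF this] this] kpos show ?thesis by simp
      next
        assume "(u, v) \<in> F"
        from relpow_Suc_I2[OF this ret[OF this]] kpos show ?thesis by simp
      qed
    qed
    have ukm: "(u, u) \<in> F ^^ (k * i)" for i
    proof (induction i)
      case (Suc i)
      then show ?case using relpow_trans[OF uk Suc] by simp
    qed simp
    \<comment> \<open>A path from \<open>u\<close> into \<open>w\<close> that respects positions
      modulo \<open>k\<close>: an arc from \<open>u\<close> is used directly, while an arc from
      \<open>w i\<close> to \<open>u\<close> is replaced by its return path, and
      \<open>i - (k - 1)\<close> is congruent to \<open>i + 1\<close>.\<close>
    have enter: "\<exists>a i. a \<le> k - 1 \<and> i < k \<and> (u, w i) \<in> F ^^ a \<and> int k dvd int i - int a - p" if "p \<in> P" for p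
      using that unfolding P_def
    proof (elim UnE imageE)
      fix i assume "p = int i + 1" "i \<in> A"
      then show ?thesis using ret[of "w i" u] kpos
        by (intro exI[of _ "k - 1"] exI[of _ i]) (auto simp: A_def of_nat_diff)
    next
      fix i assume "p = int i - 1" "i \<in> B"
      then show ?thesis using k by (intro exI[of _ 1] exI[of _ i]) (auto simp: B_def)
    qed
    have leave: "\<exists>b j. b \<le> k - 1 \<and> j < k \<and> (w j, u) \<in> F ^^ b \<and> int k dvd int j + int b - q" if "q \<in> P" for q
      using that unfolding P_def
    proof (elim UnE imageE)
      fix i assume "q = int i + 1" "i \<in> A"
      then show ?thesis using k by (intro exI[of _ 1] exI[of _ i]) (auto simp: A_def)
    next
      fix i assume "q = int i - 1" "i \<in> B"
      then show ?thesis using ret[of u "w i"] kpos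
        by (intro exI[of _ "k - 1"] exI[of _ i]) (auto simp: B_def of_nat_diff)
    qed
    have step: "\<exists>n. n \<le> 3 * (k - 1) \<and> (u, u) \<in> F ^^ n \<and> int k dvd int n - x" if "x \<in> D" for x
    proof -
      from that obtain p q where pq: "x = q - p" "p \<in> P" "q \<in> P" by (auto simp: D_def)
      from enter[OF pq(2)] obtain a i
        where a: "a \<le> k - 1" "i < k" "(u, w i) \<in> F ^^ a" "int k dvd int i - int a - p" by blast
      from leave[OF pq(3)] obtain b j
        where b: "b \<le> k - 1" "j < k" "(w j, u) \<in> F ^^ b" "int k dvd int j + int b - q" by blast
      \<comment> \<open>The number of steps along \<open>w\<close> from \<open>w i\<close> to
        \<open>w j\<close>. The whole tour then has length \<open>a + c + b\<close>, congruent to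
        \<open>(i - p) + (j - i) + (q - j) = q - p\<close>.\<close>
      define c where "c = nat ((int j - int i) mod int k)"
      have c: "int c = (int j - int i) mod int k" using kpos by (simp add: c_def)
      have c_le: "c \<le> k - 1"
      proof -
        have "int c < int k" using kpos by (simp add: c)
        then show ?thesis by simp
      qed
      have c_dvd: "int k dvd int c - (int j - int i)"
        unfolding c by (simp add: mod_eq_dvd_iff[symmetric])
      have "int ((i + c) mod k) = int j mod int k"
        by (simp add: zmod_int c mod_add_right_eq)
      then have "(i + c) mod k = j" using b(2) by (simp add: zmod_int[symmetric])
      then have "(w i, w j) \<in> F ^^ c"
        using closed_walks_relpow[OF w kpos, of i c] a(2) by simp
      from relpow_trans[OF relpow_trans[OF a(3) this] b(3)]
      have "(u, u) \<in> F ^^ (a + c + b)" .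
      moreover have "a + c + b \<le> 3 * (k - 1)" using a(1) b(1) c_le by linarith
      moreover have "int k dvd int (a + c + b) - x"
      proof -
        have "int k dvd (int j + int b - q) - (int i - int a - p) + (int c - (int j - int i))"
          using a(4) b(4) c_dvd by (blast intro: dvd_add dvd_diff)
        then show ?thesis by (simp add: pq(1) algebra_simps)
      qed
      ultimately show ?thesis by blast
    qed
    have walk: "\<exists>n. n \<le> t * (3 * (k - 1)) \<and> (u, u) \<in> F ^^ n \<and> int k dvd int n - x"
      if "x \<in> residue_sums k D t" for t x
      using that
    proof (induction t arbitrary: x)
      case 0
      then show ?case by (intro exI[of _ 0]) auto
    next
      case (Suc t)
      then obtain y z where yz: "x = y + z" "y \<in> residue_sums k D t" "z \<in> D" by auto
      from Suc.IH[OF yz(2)] obtain n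
        where n: "n \<le> t * (3 * (k - 1))" "(u, u) \<in> F ^^ n" "int k dvd int n - y" by blast
      from step[OF yz(3)] obtain n'
        where n': "n' \<le> 3 * (k - 1)" "(u, u) \<in> F ^^ n'" "int k dvd int n' - z" by blast
      have "int k dvd (int n - y) + (int n' - z)" using n(3) n'(3) by (rule dvd_add)
      then have "int k dvd int (n + n') - x" by (simp add: yz(1) algebra_simps)
      moreover have "n + n' \<le> Suc t * (3 * (k - 1))" using n(1) n'(1) by simp
      moreover have "(u, u) \<in> F ^^ (n + n')" using n(2) n'(2) by (rule relpow_trans)
      ultimately show ?case by blast
    qed
    obtain g where g: "g dvd k" "residue_sums k D (k div 2) = {x. int g dvd x}"
      using residue_sums_eq_multiples[OF kpos D0 Dsym] by blast
    \<comment> \<open>If \<open>g\<close> divided \<open>l\<close>, then \<open>l\<close> would be a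
      sum of \<open>k div 2\<close> differences modulo \<open>k\<close>, so there would be a closed
      walk at \<open>u\<close> of some length \<open>n\<close> congruent to \<open>l\<close>. The
      length bound gives \<open>n \<le> l\<close>, and closed walks of length \<open>k\<close> fill
      the gap up to exactly \<open>l\<close>.\<close>
    have gl: "\<not> g dvd l"
    proof
      assume "g dvd l"
      then have "int l \<in> residue_sums k D (k div 2)" by (simp add: g(2))
      from walk[OF this] obtain n where n: "n \<le> (k div 2) * (3 * (k - 1))"
        "(u, u) \<in> F ^^ n" "int k dvd int n - int l" by blast
      have nl: "n \<le> l" using n(1) length_bound_arith[OF k] l by linarith
      have "int k dvd int (l - n)" using n(3) nl by (metis dvd_diff_commute of_nat_diff)
      then obtain i where "l - n = k * i" by (auto simp only: of_nat_dvd_iff elim: dvdE)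
      then have "l = n + k * i" using nl by simp
      then have "(u, u) \<in> F ^^ l" using relpow_trans[OF n(2) ukm[of i]] by simp
      with no_l show False ..
    qed
    have gpos: "g > 0" using g(1) kpos by (auto intro: Nat.gr0I)
    have "D \<subseteq> residue_sums k D (Suc 0)"
      by (auto simp del: residue_sums.simps(2) intro: residue_sums_SucI[of 0])
    then have Dg: "int g dvd x" if "x \<in> D" for x
      using residue_sums_stable[OF kpos D0 Dsym, of "Suc 0"] g(2) that by blast
    have Pg: "int g dvd q - p" if "p \<in> P" "q \<in> P" for p q
      using Dg that by (auto simp: D_def)
    have AA: "int g dvd int i - int j" if "i \<in> A" "j \<in> A" for i j
      using Pg[of "int j + 1" "int i + 1"] that by (auto simp: P_def)
    have BB: "int g dvd int i - int j" if "i \<in> B" "j \<in> B" for i j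
      using Pg[of "int j - 1" "int i - 1"] that by (auto simp: P_def)
    have AB: "int g dvd int i - int j + 2" if "i \<in> A" "j \<in> B" for i j
      using Pg[of "int j - 1" "int i + 1"] that by (auto simp: P_def algebra_simps)
    have sub: "A \<subseteq> {..<k}" "B \<subseteq> {..<k}" by (auto simp: A_def B_def)
    have "d * (card A + card B) \<le> 2 * k"
    \<comment> \<open>\<open>A\<close> lies in one class modulo \<open>g\<close>, and so does
      \<open>B\<close>. If \<open>g > 2\<close>, minimality gives \<open>d \<le> g\<close>, and
      bounding the two sets separately is enough.\<close>
    proof (cases "g > 2")
      case True
      have "d \<le> g" using dmin[OF True g(1) gl] .
      have "g * card A \<le> k" "g * card B \<le> k"
        using card_congruent_le[OF gpos g(1)] sub AA BB by blast+
      then have "g * (card A + card B) \<le> 2 * k" by (simp add: algebra_simps)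
      then show ?thesis using mult_le_mono1[OF \<open>d \<le> g\<close>, of "card A + card B"] by linarith
    next
      case False
      have "g \<noteq> 1" using gl by auto
      with False gpos have g2: "g = 2" by linarith
      \<comment> \<open>For \<open>g = 2\<close> the offset 2 between the two classes vanishes, so
        \<open>A\<close> and \<open>B\<close> are disjoint subsets of a single class. This halves
        the bound and makes up for knowing only \<open>d \<le> 4\<close>.\<close>
      have AB2: "int g dvd int i - int j" if "i \<in> A" "j \<in> B" for i j
        using AB[OF that] unfolding g2 by (simp add: dvd_add_left_iff)
      have "A \<inter> B = {}" using asym by (auto simp: A_def B_def)
      moreover have "g * card (A \<union> B) \<le> k"
      proof (rule card_congruent_le[OF gpos g(1)])
        show "A \<union> B \<subseteq> {..<k}" using sub by blast
        show "int g dvd int i - int j" if "i \<in> A \<union> B" "j \<in> A \<union> B" for i j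
          using that AA[of i j] BB[of i j] AB2[of i j] AB2[of j i]
          by (auto simp: dvd_diff_commute)
      qed
      moreover have "finite A" "finite B" by (simp_all add: A_def B_def)
      ultimately have "2 * (card A + card B) \<le> k" by (simp add: card_Un_disjoint g2)
      moreover have "d \<le> 4" using par g(1) gl unfolding g2 by blast
      ultimately have "4 * (card A + card B) \<le> 2 * k" by linarith
      then show ?thesis using mult_le_mono1[OF \<open>d \<le> 4\<close>, of "card A + card B"] by linarith
    qed
    then show ?thesis unfolding A_def B_def .
  qed
qed

section \<open>Counting closed walks by random walks\<close>

lemma sum_PiE_insert:
  assumes "v \<notin> J"
  shows "(\<Sum>x \<in> insert v J \<rightarrow>\<^sub>E V. F x) = (\<Sum>z \<in> J \<rightarrow>\<^sub>E V. \<Sum>a\<in>V. F (z(v := a)))"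
proof -
  have "(\<Sum>x \<in> insert v J \<rightarrow>\<^sub>E V. F x) = (\<Sum>(a, z) \<in> V \<times> (J \<rightarrow>\<^sub>E V). F (z(v := a)))"
    unfolding PiE_insert_eq
    by (subst sum.reindex[OF inj_combinator[OF assms]]) (simp add: case_prod_unfold comp_def)
  also have "\<dots> = (\<Sum>a\<in>V. \<Sum>z \<in> J \<rightarrow>\<^sub>E V. F (z(v := a)))"
    by (rule sum.cartesian_product[symmetric])
  also have "\<dots> = (\<Sum>z \<in> J \<rightarrow>\<^sub>E V. \<Sum>a\<in>V. F (z(v := a)))"
    by (rule sum.swap)
  finally show ?thesis .
qed

text \<open>The summands are the probabilities of the paths of the simple random walk, up to the choice of the start.\<close>

lemma sum_walk_weights_le:
  assumes "finite V"
  shows "(\<Sum>w \<in> {w \<in> {..<Suc n} \<rightarrow>\<^sub>E V. \<forall>i<n. (w i, w (Suc i)) \<in> E}.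
            \<Prod>i<n. 1 / real (card {u \<in> V. (w i, u) \<in> E})) \<le> real (card V)"
proof (induction n)
  case 0
  show ?case using assms by (simp add: card_PiE)
next
  case (Suc n)
  define deg where "deg a = real (card {u \<in> V. (a, u) \<in> E})" for a
  define W where "W n = {w \<in> {..<Suc n} \<rightarrow>\<^sub>E V. \<forall>i<n. (w i, w (Suc i)) \<in> E}" for n
  define f where "f n w = (\<Prod>i<n. 1 / deg (w i))" for n and w :: "nat \<Rightarrow> 'a"
  have fin: "finite ({..<m} \<rightarrow>\<^sub>E V)" for m :: nat by (rule finite_PiE) (use assms in auto)
  have fnn: "f n w \<ge> 0" for n w by (auto simp: f_def deg_def intro!: prod_nonneg)
  have "(\<Sum>w\<in>W (Suc n). f (Suc n) w)
      = (\<Sum>w \<in> insert (Suc n) {..<Suc n} \<rightarrow>\<^sub>E V.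
           if \<forall>i<Suc n. (w i, w (Suc i)) \<in> E then f (Suc n) w else 0)"
    unfolding W_def lessThan_Suc[symmetric] using fin by (intro sum.inter_filter) auto
  also have "\<dots> = (\<Sum>w \<in> {..<Suc n} \<rightarrow>\<^sub>E V. \<Sum>a\<in>V.
      if \<forall>i<Suc n. ((w(Suc n := a)) i, (w(Suc n := a)) (Suc i)) \<in> E then f (Suc n) (w(Suc n := a)) else 0)"
    by (rule sum_PiE_insert) simp
  also have "\<dots> = (\<Sum>w \<in> {..<Suc n} \<rightarrow>\<^sub>E V. \<Sum>a\<in>V.
      if (\<forall>i<n. (w i, w (Suc i)) \<in> E) \<and> (w n, a) \<in> E then f n w * (1 / deg (w n)) else 0)"
  proof (intro sum.cong refl)
    fix w a assume "a \<in> V"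
    have "(\<forall>i<Suc n. ((w(Suc n := a)) i, (w(Suc n := a)) (Suc i)) \<in> E)
        \<longleftrightarrow> (\<forall>i<n. (w i, w (Suc i)) \<in> E) \<and> (w n, a) \<in> E"
      by (auto simp: less_Suc_eq)
    moreover have "f (Suc n) (w(Suc n := a)) = f n w * (1 / deg (w n))"
      unfolding f_def by simp
    ultimately show "(if \<forall>i<Suc n. ((w(Suc n := a)) i, (w(Suc n := a)) (Suc i)) \<in> E
        then f (Suc n) (w(Suc n := a)) else 0)
      = (if (\<forall>i<n. (w i, w (Suc i)) \<in> E) \<and> (w n, a) \<in> E then f n w * (1 / deg (w n)) else 0)"
      by (simp only:)
  qed
  also have "\<dots> \<le> (\<Sum>w \<in> {..<Suc n} \<rightarrow>\<^sub>E V. if \<forall>i<n. (w i, w (Suc i)) \<in> E then f n w else 0)"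
  proof (rule sum_mono)
    fix w
    show "(\<Sum>a\<in>V. if (\<forall>i<n. (w i, w (Suc i)) \<in> E) \<and> (w n, a) \<in> E then f n w * (1 / deg (w n)) else 0)
      \<le> (if \<forall>i<n. (w i, w (Suc i)) \<in> E then f n w else 0)"
    proof (cases "\<forall>i<n. (w i, w (Suc i)) \<in> E")
      case True
      have "(\<Sum>a\<in>V. if (w n, a) \<in> E then f n w * (1 / deg (w n)) else 0)
          = (\<Sum>a\<in>{a \<in> V. (w n, a) \<in> E}. f n w * (1 / deg (w n)))"
        using assms by (rule sum.inter_filter[symmetric])
      also have "\<dots> = f n w * (deg (w n) / deg (w n))" by (simp add: deg_def)
      \<comment> \<open>The transition probabilities out of \<open>w n\<close> add up to 1, or to 0
        at a dead end, where division by zero yields 0.\<close>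
      also have "\<dots> \<le> f n w * 1" by (intro mult_left_mono fnn) simp
      finally show ?thesis using True by simp
    next
      case False
      then show ?thesis by (simp add: sum.neutral del: not_all)
    qed
  qed
  also have "\<dots> = (\<Sum>w\<in>W n. f n w)"
    unfolding W_def using fin by (intro sum.inter_filter[symmetric])
  also have "\<dots> \<le> real (card V)" using Suc.IH unfolding W_def f_def deg_def .
  finally show ?case unfolding W_def f_def deg_def .
qed

section \<open>Rotating and reversing closed walks\<close>

lemma rotate_closed_walk:
  assumes "w \<in> closed_walks k E V" "k > 0"
  shows "(\<lambda>i\<in>{..<k}. w ((i + r) mod k)) \<in> closed_walks k E V"
proof -
  have "w ((i + r) mod k) \<in> V" for i
    using assms by (auto simp: closed_walks_def)
  moreover have "(w ((i + r) mod k), w ((Suc i mod k + r) mod k)) \<in> E" for i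
  proof -
    have "(w ((i + r) mod k), w (Suc ((i + r) mod k) mod k)) \<in> E"
      using assms by (simp add: closed_walks_def)
    then show ?thesis by (simp add: mod_simps)
  qed
  ultimately show ?thesis using assms(2) by (auto simp: closed_walks_def)
qed

lemma mod_add_surj:
  fixes j k r :: nat
  assumes "j < k"
  obtains i where "i < k" "(i + r) mod k = j"
proof
  show "(j + (k - r mod k)) mod k < k" using assms by simp
  have "((j + (k - r mod k)) mod k + r) mod k = (j + (k - r mod k) + r mod k) mod k"
    by (simp add: mod_simps)
  also have "j + (k - r mod k) + r mod k = j + k"
    using assms mod_less_divisor[of k r] by linarith
  also have "\<dots> mod k = j" using assms by simp
  finally show "((j + (k - r mod k)) mod k + r) mod k = j" .
qed

lemma bij_betw_add_mod:
  fixes k r :: nat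
  assumes "k > 0"
  shows "bij_betw (\<lambda>i. (i + r) mod k) {..<k} {..<k}"
proof -
  let ?f = "\<lambda>i. (i + r) mod k"
  have surj: "?f ` {..<k} = {..<k}"
  proof
    show "?f ` {..<k} \<subseteq> {..<k}" using assms by auto
    show "{..<k} \<subseteq> ?f ` {..<k}"
    proof
      fix j assume "j \<in> {..<k}"
      then obtain i where "i < k" "(i + r) mod k = j" using mod_add_surj[of j k r] by blast
      then show "j \<in> ?f ` {..<k}" by (intro image_eqI[of _ _ i]) auto
    qed
  qed
  moreover have "inj_on ?f {..<k}"
    by (rule eq_card_imp_inj_on) (simp_all only: surj, simp)
  ultimately show ?thesis unfolding bij_betw_def by blast
qed

lemma rotate_eqD:
  fixes w w' :: "nat \<Rightarrow> 'a"
  assumes "(\<lambda>i\<in>{..<k}. w ((i + r) mod k)) = (\<lambda>i\<in>{..<k}. w' ((i + r) mod k))"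
    and "w \<in> extensional {..<k}" "w' \<in> extensional {..<k}"
  shows "w = w'"
proof (rule extensionalityI[OF assms(2,3)])
  fix j assume "j \<in> {..<k}"
  then obtain i where "i < k" "(i + r) mod k = j" using mod_add_surj[of j k r] by blast
  with fun_cong[OF assms(1), of i] show "w j = w' j" by simp
qed

text \<open>Rotated by \<open>Suc r\<close>, a closed walk becomes a walk of \<open>k - 1\<close>
  steps that ends at its old position \<open>r\<close>. The random walk bound has no factor for the
  last vertex, which is exactly the omitted one.\<close>

lemma sum_closed_walk_weights_le:
  assumes V: "finite V" and r: "r < k"
  shows "(\<Sum>w \<in> closed_walks k E V. \<Prod>i\<in>{..<k} - {r}. 1 / real (card {u \<in> V. (w i, u) \<in> E}))
    \<le> real (card V)"
proof -
  define q where "q a = 1 / real (card {u \<in> V. (a, u) \<in> E})" for a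
  define rot where "rot w = (\<lambda>i\<in>{..<k}. w ((i + Suc r) mod k))" for w :: "nat \<Rightarrow> 'a"
  define W where "W = {w \<in> {..<Suc (k - 1)} \<rightarrow>\<^sub>E V. \<forall>i<k - 1. (w i, w (Suc i)) \<in> E}"
  have kpos: "k > 0" using r by simp
  have inj: "inj_on rot (closed_walks k E V)"
    unfolding rot_def by (rule inj_onI, erule rotate_eqD) (auto simp: closed_walks_def PiE_def)
  have rotW: "rot ` closed_walks k E V \<subseteq> W"
  proof -
    have "closed_walks k E V \<subseteq> W"
    proof
      fix w assume w: "w \<in> closed_walks k E V"
      then have "(w i, w (Suc i)) \<in> E" if "i < k - 1" for i
        using that by (force simp: closed_walks_def dest!: spec[of _ i])
      then show "w \<in> W" using w kpos by (simp add: W_def closed_walks_def)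
    qed
    then show ?thesis using rotate_closed_walk kpos unfolding rot_def by blast
  qed
  have finW: "finite W"
    unfolding W_def by (rule finite_subset[of _ "{..<Suc (k - 1)} \<rightarrow>\<^sub>E V"]) (auto intro!: finite_PiE V)
  have bij: "bij_betw (\<lambda>i. (i + Suc r) mod k) {..<k - 1} ({..<k} - {r})"
  proof -
    let ?f = "\<lambda>i. (i + Suc r) mod k"
    have surj: "?f ` {..<k} = {..<k}" and injf: "inj_on ?f {..<k}"
      using bij_betw_add_mod[OF kpos, of "Suc r"] unfolding bij_betw_def by blast+
    have last: "?f (k - 1) = r" using r by simp
    have dom: "{..<k - 1} = {..<k} - {k - 1}" by auto
    have "?f ` ({..<k} - {k - 1}) = ?f ` {..<k} - ?f ` {k - 1}"
      using kpos by (intro inj_on_image_set_diff[OF injf]) auto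
    then have "?f ` {..<k - 1} = {..<k} - {r}" by (simp only: dom surj image_insert image_empty last)
    moreover have "inj_on ?f {..<k - 1}" by (rule inj_on_subset[OF injf]) auto
    ultimately show ?thesis unfolding bij_betw_def by blast
  qed
  have "(\<Sum>w \<in> closed_walks k E V. \<Prod>i\<in>{..<k} - {r}. q (w i))
      = (\<Sum>w \<in> closed_walks k E V. \<Prod>i<k - 1. q (rot w i))"
  proof (rule sum.cong[OF refl])
    fix w
    have "(\<Prod>i\<in>{..<k} - {r}. q (w i)) = (\<Prod>i<k - 1. q (w ((i + Suc r) mod k)))"
      by (rule prod.reindex_bij_betw[OF bij, symmetric])
    also have "\<dots> = (\<Prod>i<k - 1. q (rot w i))"
      by (rule prod.cong[OF refl]) (auto simp: rot_def)
    finally show "(\<Prod>i\<in>{..<k} - {r}. q (w i)) = (\<Prod>i<k - 1. q (rot w i))" .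
  qed
  also have "\<dots> = (\<Sum>w \<in> rot ` closed_walks k E V. \<Prod>i<k - 1. q (w i))"
    by (subst sum.reindex[OF inj]) simp
  also have "\<dots> \<le> (\<Sum>w\<in>W. \<Prod>i<k - 1. q (w i))"
    by (rule sum_mono2[OF finW rotW]) (auto simp: q_def intro!: prod_nonneg)
  also have "\<dots> \<le> real (card V)"
    unfolding W_def q_def by (rule sum_walk_weights_le[OF V])
  finally show ?thesis unfolding q_def .
qed

text \<open>Reversal turns indegrees into outdegrees of the converse relation. Position
  \<open>i\<close> moves to \<open>k - 1 - i\<close>, and so does the omitted index.\<close>

lemma sum_closed_walk_weights_in_le:
  assumes V: "finite V" and r: "r < k"
  shows "(\<Sum>w \<in> closed_walks k E V. \<Prod>i\<in>{..<k} - {r}. 1 / real (card {u \<in> V. (u, w i) \<in> E}))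
    \<le> real (card V)"
proof -
  define q where "q a = 1 / real (card {u \<in> V. (a, u) \<in> E\<inverse>})" for a
  define rv where "rv w = (\<lambda>i\<in>{..<k}. w (k - 1 - i))" for w :: "nat \<Rightarrow> 'a"
  have inj: "inj_on rv (closed_walks k E V)"
  proof
    fix w w' assume w: "w \<in> closed_walks k E V" "w' \<in> closed_walks k E V" and eq: "rv w = rv w'"
    show "w = w'"
    proof (rule extensionalityI[of _ "{..<k}"])
      fix j assume j: "j \<in> {..<k}"
      then show "w j = w' j" using fun_cong[OF eq, of "k - 1 - j"] by (simp add: rv_def)
    qed (use w in \<open>auto simp: closed_walks_def PiE_def\<close>)
  qed
  have sub: "rv ` closed_walks k E V \<subseteq> closed_walks k (E\<inverse>) V"
  proof
    fix x assume "x \<in> rv ` closed_walks k E V"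
    then obtain w where w: "w \<in> closed_walks k E V" "x = rv w" by blast
    have "(x i, x (Suc i mod k)) \<in> E\<inverse>" if i: "i < k" for i
    proof -
      define j where "j = k - 1 - Suc i mod k"
      have j: "j < k" "Suc j mod k = k - 1 - i"
        using i by (auto simp: j_def mod_Suc)
      then have "(w j, w (Suc j mod k)) \<in> E" using w(1) by (auto simp: closed_walks_def)
      moreover have "x (Suc i mod k) = w j" using i by (simp add: w(2) rv_def j_def)
      moreover have "x i = w (Suc j mod k)" using i by (simp add: w(2) rv_def j(2))
      ultimately show ?thesis by simp
    qed
    moreover have "x \<in> {..<k} \<rightarrow>\<^sub>E V" using w by (auto simp: closed_walks_def rv_def)
    ultimately show "x \<in> closed_walks k (E\<inverse>) V" by (simp add: closed_walks_def)
  qed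
  have bij: "bij_betw (\<lambda>i. k - 1 - i) ({..<k} - {k - 1 - r}) ({..<k} - {r})"
    by (rule bij_betw_byWitness[where f' = "\<lambda>i. k - 1 - i"]) (use r in auto)
  have "(\<Sum>w \<in> closed_walks k E V. \<Prod>i\<in>{..<k} - {r}. q (w i))
      = (\<Sum>w \<in> closed_walks k E V. \<Prod>i\<in>{..<k} - {k - 1 - r}. q (rv w i))"
  proof (rule sum.cong[OF refl])
    fix w
    have "(\<Prod>i\<in>{..<k} - {r}. q (w i)) = (\<Prod>i\<in>{..<k} - {k - 1 - r}. q (w (k - 1 - i)))"
      by (rule prod.reindex_bij_betw[OF bij, symmetric])
    also have "\<dots> = (\<Prod>i\<in>{..<k} - {k - 1 - r}. q (rv w i))"
      by (rule prod.cong[OF refl]) (auto simp: rv_def)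
    finally show "(\<Prod>i\<in>{..<k} - {r}. q (w i)) = (\<Prod>i\<in>{..<k} - {k - 1 - r}. q (rv w i))" .
  qed
  also have "\<dots> = (\<Sum>w \<in> rv ` closed_walks k E V. \<Prod>i\<in>{..<k} - {k - 1 - r}. q (w i))"
    by (subst sum.reindex[OF inj]) simp
  also have "\<dots> \<le> (\<Sum>w\<in>closed_walks k (E\<inverse>) V. \<Prod>i\<in>{..<k} - {k - 1 - r}. q (w i))"
    by (rule sum_mono2[OF finite_closed_walks[OF V] sub]) (auto simp: q_def intro!: prod_nonneg)
  also have "\<dots> \<le> real (card V)"
    unfolding q_def by (rule sum_closed_walk_weights_le[OF V]) (use r in simp)
  finally show ?thesis unfolding q_def by simp
qed

lemma sum_card_swap:
  assumes "finite A" "finite B"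
  shows "(\<Sum>a\<in>A. card {b \<in> B. P a b}) = (\<Sum>b\<in>B. card {a \<in> A. P a b})"
  using sum.swap_restrict[OF assms, of "\<lambda>_ _. 1 :: nat" P] by simp

text \<open>The inequality \<open>1 + ln x \<le> x\<close> is applied to each product of the
  \<open>c / x i\<close>. Over all \<open>r\<close> each logarithm is omitted once and hence occurs
  \<open>k - 1\<close> times. As the bound is linear in the logarithms, those for out- and indegrees
  can later be added.\<close>

lemma sum_omit_one_weights_ge:
  fixes x :: "nat \<Rightarrow> real"
  assumes pos: "\<And>i. i < k \<Longrightarrow> x i > 0" and c: "c > 0" and k: "k > 0"
  shows "c ^ (k - 1) * (\<Sum>r<k. \<Prod>i\<in>{..<k} - {r}. 1 / x i) \<ge> k - real (k - 1) * (\<Sum>i<k. ln (x i / c))"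
proof -
  have "c ^ (k - 1) * (\<Prod>i\<in>{..<k} - {r}. 1 / x i) \<ge> 1 - ((\<Sum>i<k. ln (x i / c)) - ln (x r / c))" if r: "r < k" for r
  proof -
    have "c ^ (k - 1) * (\<Prod>i\<in>{..<k} - {r}. 1 / x i) = (\<Prod>i\<in>{..<k} - {r}. c) * (\<Prod>i\<in>{..<k} - {r}. 1 / x i)"
      using r by simp
    also have "\<dots> = (\<Prod>i\<in>{..<k} - {r}. c / x i)"
      unfolding prod.distrib[symmetric] by simp
    finally have eq: "c ^ (k - 1) * (\<Prod>i\<in>{..<k} - {r}. 1 / x i) = (\<Prod>i\<in>{..<k} - {r}. c / x i)" .
    have "(\<Prod>i\<in>{..<k} - {r}. c / x i) > 0" by (rule prod_pos) (use pos c in auto)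
    then have "(\<Prod>i\<in>{..<k} - {r}. c / x i) \<ge> 1 + ln (\<Prod>i\<in>{..<k} - {r}. c / x i)"
      using ln_le_minus_one by fastforce
    also have "ln (\<Prod>i\<in>{..<k} - {r}. c / x i) = (\<Sum>i\<in>{..<k} - {r}. ln (c / x i))"
      by (rule ln_prod) (use c in \<open>auto dest: pos\<close>)
    also have "\<dots> = (\<Sum>i\<in>{..<k} - {r}. - ln (x i / c))"
      by (rule sum.cong) (use pos c in \<open>force simp: ln_div\<close>)+
    also have "\<dots> = - ((\<Sum>i<k. ln (x i / c)) - ln (x r / c))"
      using r by (simp add: sum_negf sum_diff1)
    finally show ?thesis using eq by simp
  qed
  then have "(\<Sum>r<k. 1 - ((\<Sum>i<k. ln (x i / c)) - ln (x r / c)))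
     \<le> (\<Sum>r<k. c ^ (k - 1) * (\<Prod>i\<in>{..<k} - {r}. 1 / x i))"
    by (intro sum_mono) auto
  also have "(\<Sum>r<k. 1 - ((\<Sum>i<k. ln (x i / c)) - ln (x r / c)))
     = k - real (k - 1) * (\<Sum>i<k. ln (x i / c))"
    using k by (simp add: sum_subtractf sum.distrib of_nat_diff algebra_simps)
  finally show ?thesis by (simp add: sum_distrib_left)
qed

text \<open>Weights are counted in two ways. Scaled by \<open>c ^ (k - 1)\<close> and summed over
  the omitted index and both directions, every closed walk carries weight at least
  \<open>2 * k\<close>, while each of the \<open>2 * k\<close> random walk bounds allows a total of
  at most \<open>m\<close> before scaling.\<close>

lemma card_closed_walks_le:
  assumes k: "k \<ge> 3" and l: "l \<ge> 2 * (k - 1)^2" and d: "d > 0"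
    and dmin: "\<And>e. e > 2 \<Longrightarrow> e dvd k \<Longrightarrow> \<not> e dvd l \<Longrightarrow> d \<le> e"
    and par: "2 dvd k \<Longrightarrow> \<not> 2 dvd l \<Longrightarrow> d \<le> 4"
    and V: "finite V"
    and asym: "\<And>a b. (a, b) \<in> E \<Longrightarrow> (b, a) \<notin> E"
    and no_l: "\<And>u. u \<in> V \<Longrightarrow> (u, u) \<notin> E ^^ l"
  shows "real (card (closed_walks k E V)) \<le> real (card V) * (real (card V) / real d) ^ (k - 1)"
proof (cases "closed_walks k E V = {}")
  case False
  define F where "F = walk_arcs k E V"
  define C where "C = closed_walks k F V"
  define outd where "outd a = real (card {u \<in> V. (a, u) \<in> F})" for a
  define ind where "ind a = real (card {u \<in> V. (u, a) \<in> F})" for a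
  define m where "m = real (card V)"
  define c where "c = m / real d"
  have kpos: "k > 0" using k by simp
  have CE: "C = closed_walks k E V" by (simp add: C_def F_def closed_walks_walk_arcs)
  have "V \<noteq> {}"
  proof
    assume "V = {}"
    then have "closed_walks k E V = {}" using kpos by (auto simp: closed_walks_def)
    with False show False ..
  qed
  then have m: "m > 0" using V by (simp add: m_def card_gt_0_iff)
  have c: "c > 0" using m d by (simp add: c_def)
  have FE: "F \<subseteq> E" unfolding F_def by (rule walk_arcs_subset)
  \<comment> \<open>The degrees along \<open>w\<close> average at most \<open>c\<close>; AM-GM, in the form \<open>ln x \<le> x - 1\<close>, is used twice.\<close>
  have lower: "2 * real k \<le> c ^ (k - 1) * ((\<Sum>r<k. \<Prod>i\<in>{..<k} - {r}. 1 / outd (w i))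
      + (\<Sum>r<k. \<Prod>i\<in>{..<k} - {r}. 1 / ind (w i)))" if w: "w \<in> C" for w
  proof -
    have wV: "w i \<in> V" if "i < k" for i using w that by (auto simp: C_def closed_walks_def)
    have out_pos: "outd (w i) > 0" if i: "i < k" for i
    proof -
      have "w (Suc i mod k) \<in> {u \<in> V. (w i, u) \<in> F}"
        using w i wV by (auto simp: C_def closed_walks_def)
      then show ?thesis using V by (auto simp: outd_def card_gt_0_iff)
    qed
    have in_pos: "ind (w i) > 0" if i: "i < k" for i
    proof -
      define j where "j = (i + (k - 1)) mod k"
      have j: "j < k" "Suc j mod k = i" using i by (auto simp: j_def mod_Suc_eq)
      then have "w j \<in> {u \<in> V. (u, w i) \<in> F}"
        using w wV by (auto simp: C_def closed_walks_def)
      then show ?thesis using V by (auto simp: ind_def card_gt_0_iff)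
    qed
    have adj: "d * (card {i \<in> {..<k}. (w i, u) \<in> F} + card {i \<in> {..<k}. (u, w i) \<in> F}) \<le> 2 * k"
      if "u \<in> V" for u
    proof (rule closed_walk_adjacency_le[OF k l dmin par])
      show "\<And>a b. (a, b) \<in> F \<Longrightarrow> (b, a) \<notin> F" using asym FE by blast
      show "\<And>a b. (a, b) \<in> F \<Longrightarrow> (b, a) \<in> F ^^ (k - 1)"
        unfolding F_def by (rule walk_arcs_return[OF kpos])
      show "(u, u) \<notin> F ^^ l" using no_l[OF that] FE unfolding relpow_fun_conv by blast
      show "w \<in> closed_walks k F V" using w by (simp add: C_def)
    qed
    \<comment> \<open>The arcs between \<open>V\<close> and the walk are counted by index on one
      side and by vertex on the other, so \<open>adj\<close> bounds the sum of degrees.\<close>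
    have "(\<Sum>i<k. outd (w i) + ind (w i))
        = real (\<Sum>u\<in>V. card {i \<in> {..<k}. (w i, u) \<in> F} + card {i \<in> {..<k}. (u, w i) \<in> F})"
      unfolding outd_def ind_def sum.distrib of_nat_sum[symmetric] of_nat_add[symmetric]
      using sum_card_swap[OF _ V, of "{..<k}" "\<lambda>i u. (w i, u) \<in> F"]
        sum_card_swap[OF _ V, of "{..<k}" "\<lambda>i u. (u, w i) \<in> F"] by simp
    then have "real d * (\<Sum>i<k. outd (w i) + ind (w i))
        = real (\<Sum>u\<in>V. d * (card {i \<in> {..<k}. (w i, u) \<in> F} + card {i \<in> {..<k}. (u, w i) \<in> F}))"
      by (simp add: sum_distrib_left)
    also have "\<dots> \<le> real (\<Sum>u\<in>V. 2 * k)"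
      unfolding of_nat_le_iff by (rule sum_mono) (rule adj)
    also have "\<dots> = 2 * real k * m" by (simp add: m_def)
    finally have deg: "(\<Sum>i<k. outd (w i) + ind (w i)) / c \<le> 2 * real k"
      using d m by (simp add: c_def field_simps)
    have "(\<Sum>i<k. ln (outd (w i) / c)) + (\<Sum>i<k. ln (ind (w i) / c))
        = (\<Sum>i<k. ln (outd (w i) / c) + ln (ind (w i) / c))" by (simp add: sum.distrib)
    also have "\<dots> \<le> (\<Sum>i<k. (outd (w i) / c - 1) + (ind (w i) / c - 1))"
      by (intro sum_mono add_mono ln_le_minus_one) (use out_pos in_pos c in auto)
    also have "\<dots> = (\<Sum>i<k. outd (w i) + ind (w i)) / c - 2 * real k"
      by (simp add: sum.distrib sum_subtractf sum_divide_distrib add_divide_distrib)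
    also have "\<dots> \<le> 0" using deg by simp
    finally have le0: "(\<Sum>i<k. ln (outd (w i) / c)) + (\<Sum>i<k. ln (ind (w i) / c)) \<le> 0" .
    have "real (k - 1) * ((\<Sum>i<k. ln (outd (w i) / c)) + (\<Sum>i<k. ln (ind (w i) / c))) \<le> 0"
      using le0 by (intro mult_nonneg_nonpos) auto
    moreover have "c ^ (k - 1) * (\<Sum>r<k. \<Prod>i\<in>{..<k} - {r}. 1 / outd (w i))
        \<ge> k - real (k - 1) * (\<Sum>i<k. ln (outd (w i) / c))"
      by (rule sum_omit_one_weights_ge) (use out_pos c kpos in auto)
    moreover have "c ^ (k - 1) * (\<Sum>r<k. \<Prod>i\<in>{..<k} - {r}. 1 / ind (w i))
        \<ge> k - real (k - 1) * (\<Sum>i<k. ln (ind (w i) / c))"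
      by (rule sum_omit_one_weights_ge) (use in_pos c kpos in auto)
    ultimately show ?thesis by (simp add: distrib_left)
  qed
  have "2 * real k * real (card C) = (\<Sum>w\<in>C. 2 * real k)" by simp
  also have "\<dots> \<le> (\<Sum>w\<in>C. c ^ (k - 1) * ((\<Sum>r<k. \<Prod>i\<in>{..<k} - {r}. 1 / outd (w i))
      + (\<Sum>r<k. \<Prod>i\<in>{..<k} - {r}. 1 / ind (w i))))"
    by (rule sum_mono) (rule lower)
  also have "\<dots> = c ^ (k - 1) * ((\<Sum>r<k. \<Sum>w\<in>C. \<Prod>i\<in>{..<k} - {r}. 1 / outd (w i))
      + (\<Sum>r<k. \<Sum>w\<in>C. \<Prod>i\<in>{..<k} - {r}. 1 / ind (w i)))"
    unfolding sum_distrib_left[symmetric] sum.distrib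
    by (simp only: sum.swap[of _ C "{..<k}"])
  also have "\<dots> \<le> c ^ (k - 1) * ((\<Sum>r<k. m) + (\<Sum>r<k. m))"
    unfolding outd_def ind_def C_def m_def
    by (intro mult_left_mono add_mono sum_mono sum_closed_walk_weights_le
        sum_closed_walk_weights_in_le V) (use c in auto)
  finally have "2 * real k * real (card C) \<le> 2 * real k * (m * c ^ (k - 1))" by (simp add: algebra_simps)
  then have "real (card C) \<le> m * c ^ (k - 1)" using kpos by simp
  then show ?thesis by (simp add: CE m_def c_def)
qed auto

section \<open>Splitting the vertices of a pattern\<close>

text \<open>A union bound over pairs of indices with equal values: the value at \<open>j\<close>
  repeats that at \<open>i\<close>, so the restriction away from \<open>j\<close> determines the
  map.\<close>

lemma card_non_injective_le:
  assumes "finite V"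
  shows "card {w \<in> {..<r} \<rightarrow>\<^sub>E V. \<not> inj_on w {..<r}} \<le> r^2 * card V ^ (r - 1)"
proof -
  define N where "N = (\<lambda>(i, j). {w \<in> {..<r} \<rightarrow>\<^sub>E V. i < r \<and> j < r \<and> i \<noteq> j \<and> w i = w j})"
  have fin: "finite (I \<rightarrow>\<^sub>E V)" if "finite I" for I :: "nat set"
    using assms that by (intro finite_PiE) auto
  have N: "card (N (i, j)) \<le> card V ^ (r - 1)" for i j
  proof (cases "i < r \<and> j < r \<and> i \<noteq> j")
    case True
    have "inj_on (\<lambda>w. restrict w ({..<r} - {j})) (N (i, j))"
    proof
      fix w w' assume w: "w \<in> N (i, j)" "w' \<in> N (i, j)"
        and eq: "restrict w ({..<r} - {j}) = restrict w' ({..<r} - {j})"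
      have *: "w a = w' a" if "a \<in> {..<r} - {j}" for a
        using fun_cong[OF eq, of a] that by simp
      show "w = w'"
      proof (rule extensionalityI[of _ "{..<r}"])
        show "w a = w' a" if "a \<in> {..<r}" for a
          using * [of a] * [of i] w True that by (cases "a = j") (auto simp: N_def)
      qed (use w in \<open>auto simp: N_def PiE_def\<close>)
    qed
    moreover have "(\<lambda>w. restrict w ({..<r} - {j})) ` N (i, j) \<subseteq> ({..<r} - {j}) \<rightarrow>\<^sub>E V"
      by (auto simp: N_def PiE_def Pi_def)
    ultimately have "card (N (i, j)) \<le> card (({..<r} - {j}) \<rightarrow>\<^sub>E V)"
      by (rule card_inj_on_le) (simp add: fin)
    then show ?thesis using True by (simp add: card_PiE)
  qed (auto simp: N_def)
  have "{w \<in> {..<r} \<rightarrow>\<^sub>E V. \<not> inj_on w {..<r}} \<subseteq> (\<Union>p \<in> {..<r} \<times> {..<r}. N p)"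
    by (auto simp: N_def inj_on_def)
  then have "card {w \<in> {..<r} \<rightarrow>\<^sub>E V. \<not> inj_on w {..<r}} \<le> card (\<Union>p \<in> {..<r} \<times> {..<r}. N p)"
    by (rule card_mono[rotated]) (auto simp: N_def fin)
  also have "\<dots> \<le> (\<Sum>p \<in> {..<r} \<times> {..<r}. card (N p))" by (rule card_UN_le) simp
  also have "\<dots> \<le> (\<Sum>p \<in> {..<r} \<times> {..<r}. card V ^ (r - 1))"
    using N by (intro sum_mono) auto
  also have "\<dots> = r^2 * card V ^ (r - 1)" by (simp add: power2_eq_square)
  finally show ?thesis .
qed

lemma card_injective_ge:
  assumes "finite V" "r > 0"
  shows "real (card {w \<in> {..<r} \<rightarrow>\<^sub>E V. inj_on w {..<r}}) \<ge> real (card V) ^ r - real r^2 * real (card V) ^ (r - 1)"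
proof -
  have fin: "finite ({..<r} \<rightarrow>\<^sub>E V)" using assms by (intro finite_PiE) auto
  have "card ({..<r} \<rightarrow>\<^sub>E V) = card ({w \<in> {..<r} \<rightarrow>\<^sub>E V. inj_on w {..<r}} \<union> {w \<in> {..<r} \<rightarrow>\<^sub>E V. \<not> inj_on w {..<r}})"
    by (rule arg_cong[of _ _ card]) auto
  also have "\<dots> = card {w \<in> {..<r} \<rightarrow>\<^sub>E V. inj_on w {..<r}} + card {w \<in> {..<r} \<rightarrow>\<^sub>E V. \<not> inj_on w {..<r}}"
    using fin by (intro card_Un_disjoint) auto
  finally have "card V ^ r \<le> card {w \<in> {..<r} \<rightarrow>\<^sub>E V. inj_on w {..<r}} + r^2 * card V ^ (r - 1)"
    using card_non_injective_le[OF assms(1), of r] by (simp add: card_PiE)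
  then have "real (card V ^ r) \<le> real (card {w \<in> {..<r} \<rightarrow>\<^sub>E V. inj_on w {..<r}} + r^2 * card V ^ (r - 1))"
    by (rule of_nat_mono)
  then show ?thesis by simp
qed

text \<open>\<open>x\<close> places the indices of \<open>I\<close> in the graph, and
  \<open>\<phi>\<close> lists which index each position of a closed walk uses. \<open>\<phi>\<close>
  may repeat indices, and \<open>I\<close> may contain indices outside its range, so that different
  patterns are counted over the same \<open>I\<close>.\<close>

definition pattern_maps :: "nat set \<Rightarrow> ('a \<times> 'a) set \<Rightarrow> 'a set \<Rightarrow> nat \<Rightarrow> (nat \<Rightarrow> nat) \<Rightarrow> (nat \<Rightarrow> 'a) set" where
  "pattern_maps I E V r \<phi> = {x \<in> I \<rightarrow>\<^sub>E V. \<forall>j<r. (x (\<phi> j), x (\<phi> (Suc j mod r))) \<in> E}"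

lemma finite_pattern_maps: "finite I \<Longrightarrow> finite V \<Longrightarrow> finite (pattern_maps I E V r \<phi>)"
  by (simp add: pattern_maps_def finite_PiE)

lemma pattern_maps_cong:
  assumes "\<And>j. j < r \<Longrightarrow> \<phi> j = \<psi> j"
  shows "pattern_maps I E V r \<phi> = pattern_maps I E V r \<psi>"
proof -
  have "\<phi> j = \<psi> j" "\<phi> (Suc j mod r) = \<psi> (Suc j mod r)" if "j < r" for j
    using that assms[of j] assms[of "Suc j mod r"] by auto
  then show ?thesis by (auto simp: pattern_maps_def)
qed

text \<open>With all positions on distinct indices, a map is the same as a closed walk together with
  free values on the remaining indices.\<close>

lemma card_pattern_maps_inj:
  assumes I: "finite I" and V: "finite V" and inj: "inj_on \<phi> {..<r}" and sub: "\<phi> ` {..<r} \<subseteq> I"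
  shows "card (pattern_maps I E V r \<phi>) = card (closed_walks r E V) * card V ^ (card I - r)"
proof -
  define K where "K = I - \<phi> ` {..<r}"
  define f where "f x = ((\<lambda>j\<in>{..<r}. x (\<phi> j)), restrict x K)" for x :: "nat \<Rightarrow> 'a"
  define g where "g = (\<lambda>(w, y). (\<lambda>i\<in>I. if i \<in> \<phi> ` {..<r} then w (the_inv_into {..<r} \<phi> i) else (y i :: 'a)))"
  have inv: "the_inv_into {..<r} \<phi> (\<phi> j) = j" if "j < r" for j
    using that by (simp add: the_inv_into_f_f[OF inj])
  have "bij_betw f (pattern_maps I E V r \<phi>) (closed_walks r E V \<times> (K \<rightarrow>\<^sub>E V))"
  proof (rule bij_betw_byWitness[where f' = g])
    show "\<forall>x\<in>pattern_maps I E V r \<phi>. g (f x) = x"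
    proof
      fix x assume x: "x \<in> pattern_maps I E V r \<phi>"
      show "g (f x) = x"
      proof (rule extensionalityI[of _ I])
        show "g (f x) i = x i" if "i \<in> I" for i
          using that inv by (auto simp: g_def f_def K_def)
      qed (use x in \<open>auto simp: g_def f_def pattern_maps_def PiE_def\<close>)
    qed
    show "\<forall>p\<in>closed_walks r E V \<times> (K \<rightarrow>\<^sub>E V). f (g p) = p"
    proof
      fix p assume "p \<in> closed_walks r E V \<times> (K \<rightarrow>\<^sub>E V)"
      then obtain w y where p: "p = (w, y)" "w \<in> {..<r} \<rightarrow>\<^sub>E V" "y \<in> K \<rightarrow>\<^sub>E V"
        by (auto simp: closed_walks_def)
      have "(\<lambda>j\<in>{..<r}. g p (\<phi> j)) = w"
      proof (rule extensionalityI[of _ "{..<r}"])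
        show "(\<lambda>j\<in>{..<r}. g p (\<phi> j)) j = w j" if "j \<in> {..<r}" for j
          using that inv sub by (auto simp: g_def p(1))
      qed (use p in \<open>auto simp: PiE_def\<close>)
      moreover have "restrict (g p) K = y"
      proof (rule extensionalityI[of _ K])
        show "restrict (g p) K i = y i" if "i \<in> K" for i
          using that by (auto simp: g_def p(1) K_def)
      qed (use p in \<open>auto simp: PiE_def\<close>)
      ultimately show "f (g p) = p" by (simp add: f_def p(1))
    qed
    show "f ` pattern_maps I E V r \<phi> \<subseteq> closed_walks r E V \<times> (K \<rightarrow>\<^sub>E V)"
    proof
      fix p assume "p \<in> f ` pattern_maps I E V r \<phi>"
      then obtain x where x: "x \<in> pattern_maps I E V r \<phi>" "p = f x" by blast
      have "x i \<in> V" if "i \<in> I" for i using x(1) that by (auto simp: pattern_maps_def)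
      then have "fst p \<in> {..<r} \<rightarrow>\<^sub>E V" "snd p \<in> K \<rightarrow>\<^sub>E V"
        using sub by (auto simp: x(2) f_def K_def)
      moreover have "(fst p j, fst p (Suc j mod r)) \<in> E" if "j < r" for j
        using x(1) that by (auto simp: x(2) f_def pattern_maps_def)
      ultimately show "p \<in> closed_walks r E V \<times> (K \<rightarrow>\<^sub>E V)"
        by (cases p) (auto simp: closed_walks_def)
    qed
    show "g ` (closed_walks r E V \<times> (K \<rightarrow>\<^sub>E V)) \<subseteq> pattern_maps I E V r \<phi>"
    proof
      fix x assume "x \<in> g ` (closed_walks r E V \<times> (K \<rightarrow>\<^sub>E V))"
      then obtain w y where x: "x = g (w, y)" "w \<in> closed_walks r E V" "y \<in> K \<rightarrow>\<^sub>E V" by auto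
      have xw: "x (\<phi> j) = w j" if "j < r" for j
        using that inv sub by (auto simp: x(1) g_def)
      have xV: "x \<in> I \<rightarrow>\<^sub>E V"
        using x(2,3) inv by (auto simp: x(1) g_def closed_walks_def K_def PiE_iff)
      have "(x (\<phi> j), x (\<phi> (Suc j mod r))) \<in> E" if "j < r" for j
      proof -
        have "x (\<phi> (Suc j mod r)) = w (Suc j mod r)" using that by (intro xw) auto
        then show ?thesis using x(2) that by (simp add: closed_walks_def xw)
      qed
      with xV show "x \<in> pattern_maps I E V r \<phi>" by (simp add: pattern_maps_def)
    qed
  qed
  then have "card (pattern_maps I E V r \<phi>) = card (closed_walks r E V \<times> (K \<rightarrow>\<^sub>E V))"
    by (rule bij_betw_same_card)
  also have "\<dots> = card (closed_walks r E V) * card V ^ card K"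
    using I by (simp add: card_cartesian_product card_PiE K_def)
  also have "card K = card I - r"
    using card_Diff_subset[of "\<phi> ` {..<r}" I] sub by (simp add: K_def card_image[OF inj])
  finally show ?thesis .
qed

text \<open>
  Cauchy--Schwarz over the value at the index \<open>\<phi> i\<close>: two choices of it that both fit the pattern give a map
  in which position \<open>i\<close> uses an index of its own. Loops would break this, as then two
  consecutive positions could share an index.
\<close>

lemma card_pattern_maps_split:
  assumes I: "finite I" and V: "finite V" and irrefl: "\<And>a. (a, a) \<notin> E"
    and i: "i < r" and sub: "\<phi> ` {..<r} \<subseteq> I" and f: "f \<in> I" "f \<notin> \<phi> ` {..<r}"
  shows "(card (pattern_maps I E V r \<phi>))^2
    \<le> card V ^ card I * card (pattern_maps I E V r (\<phi>(i := f)))"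
proof -
  define v where "v = \<phi> i"
  define J where "J = I - {v, f}"
  define n where "n = real (card V)"
  define Q where "Q \<psi> x \<longleftrightarrow> (\<forall>j<r. (x (\<psi> j), x (\<psi> (Suc j mod r))) \<in> E)" for \<psi> :: "nat \<Rightarrow> nat" and x
  define \<alpha> where "\<alpha> z = (\<Sum>a\<in>V. of_bool (Q \<phi> (z(v := a))) :: real)" for z
  have r: "Suc j mod r < r" for j using i by (intro mod_less_divisor) auto
  have vf: "v \<in> I" "v \<noteq> f" using i sub f by (auto simp: v_def)
  have I_eq: "I = insert f (insert v J)" using vf f by (auto simp: J_def)
  have cnt: "real (card (pattern_maps I E V r \<psi>))
      = (\<Sum>z \<in> J \<rightarrow>\<^sub>E V. \<Sum>a\<in>V. \<Sum>b\<in>V. of_bool (Q \<psi> (z(v := a, f := b))))" for \<psi>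
  proof -
    have "real (card (pattern_maps I E V r \<psi>)) = (\<Sum>x \<in> I \<rightarrow>\<^sub>E V. of_bool (Q \<psi> x))"
    proof -
      have "pattern_maps I E V r \<psi> = (I \<rightarrow>\<^sub>E V) \<inter> {x. Q \<psi> x}"
        by (auto simp only: pattern_maps_def Q_def)
      moreover have "finite (I \<rightarrow>\<^sub>E V)" using I V by (intro finite_PiE) auto
      ultimately show ?thesis by (simp only: sum_of_bool_eq)
    qed
    also have "\<dots> = (\<Sum>x \<in> insert v J \<rightarrow>\<^sub>E V. \<Sum>b\<in>V. of_bool (Q \<psi> (x(f := b))))"
      unfolding I_eq by (rule sum_PiE_insert) (use vf in \<open>auto simp: J_def\<close>)
    also have "\<dots> = (\<Sum>z \<in> J \<rightarrow>\<^sub>E V. \<Sum>a\<in>V. \<Sum>b\<in>V. of_bool (Q \<psi> (z(v := a, f := b))))"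
      by (rule sum_PiE_insert) (auto simp: J_def)
    finally show ?thesis .
  qed
  have nf: "\<phi> j \<noteq> f" if "j < r" for j using f that by auto
  have free: "Q \<phi> (x(f := b)) = Q \<phi> x" for x b
    using nf r by (auto simp: Q_def)
  \<comment> \<open>No position uses the index \<open>f\<close>, so its value is free and
    contributes a factor \<open>n\<close>.\<close>
  have c1: "real (card (pattern_maps I E V r \<phi>)) = n * (\<Sum>z \<in> J \<rightarrow>\<^sub>E V. \<alpha> z)"
    unfolding cnt free by (simp add: \<alpha>_def n_def sum_distrib_left)
  \<comment> \<open>Position \<open>i\<close> reads its vertex \<open>b\<close> from
    \<open>f\<close>, and every other position on the index \<open>v\<close> keeps \<open>a\<close>.
    Each arc involves only one of the two, since consecutive positions never share an index.\<close>
  have split: "Q (\<phi>(i := f)) (z(v := a, f := b))"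
    if Qa: "Q \<phi> (z(v := a))" and Qb: "Q \<phi> (z(v := b))" for z a b
    unfolding Q_def
  proof (intro allI impI)
    fix j assume j: "j < r"
    have A: "((z(v := a)) (\<phi> j), (z(v := a)) (\<phi> (Suc j mod r))) \<in> E"
      by (rule Qa[unfolded Q_def, rule_format, OF j])
    have B: "((z(v := b)) (\<phi> j), (z(v := b)) (\<phi> (Suc j mod r))) \<in> E"
      by (rule Qb[unfolded Q_def, rule_format, OF j])
    have ne: "\<phi> j \<noteq> \<phi> (Suc j mod r)" 
    proof
      assume e: "\<phi> j = \<phi> (Suc j mod r)"
      show False by (rule notE[OF irrefl A[unfolded e]])
    qed
    show "((z(v := a, f := b)) ((\<phi>(i := f)) j), (z(v := a, f := b)) ((\<phi>(i := f)) (Suc j mod r))) \<in> E"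
    proof (cases "j = i")
      case True
      then have "\<phi> (Suc j mod r) \<noteq> v" "Suc j mod r \<noteq> i" using ne by (auto simp: v_def)
      then show ?thesis using B True nf[OF r] by (simp add: v_def)
    next
      case False
      show ?thesis
      proof (cases "Suc j mod r = i")
        case True
        then have "\<phi> j \<noteq> v" using ne by (auto simp: v_def)
        then show ?thesis using B True False nf[OF j] by (simp add: v_def)
      next
        case False
        then show ?thesis using A \<open>j \<noteq> i\<close> nf[OF j] nf[OF r] by simp
      qed
    qed
  qed
  \<comment> \<open>The square counts pairs \<open>(a, b)\<close> of fitting values; the second one
    becomes the value at \<open>f\<close>.\<close>
  have c2: "(\<Sum>z \<in> J \<rightarrow>\<^sub>E V. (\<alpha> z)^2) \<le> real (card (pattern_maps I E V r (\<phi>(i := f))))"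
    unfolding cnt
  proof (rule sum_mono)
    fix z
    have "(\<alpha> z)^2 = (\<Sum>a\<in>V. \<Sum>b\<in>V. of_bool (Q \<phi> (z(v := a))) * of_bool (Q \<phi> (z(v := b))))"
      by (simp add: \<alpha>_def power2_eq_square sum_product)
    also have "\<dots> \<le> (\<Sum>a\<in>V. \<Sum>b\<in>V. of_bool (Q (\<phi>(i := f)) (z(v := a, f := b))))"
      by (intro sum_mono) (use split in \<open>auto simp del: fun_upd_apply\<close>)
    finally show "(\<alpha> z)^2 \<le> (\<Sum>a\<in>V. \<Sum>b\<in>V. of_bool (Q (\<phi>(i := f)) (z(v := a, f := b))))" .
  qed
  have cardJ: "real (card (J \<rightarrow>\<^sub>E V)) * n^2 = n ^ card I"
  proof -
    have "card I = card J + 2"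
      unfolding I_eq using I vf by (simp add: J_def)
    moreover have "finite J" using I by (simp add: J_def)
    then have "real (card (J \<rightarrow>\<^sub>E V)) = n ^ card J" by (simp add: card_PiE n_def)
    ultimately show ?thesis by (simp only: power_add)
  qed
  have "real (card (pattern_maps I E V r \<phi>))^2 = n^2 * (\<Sum>z \<in> J \<rightarrow>\<^sub>E V. \<alpha> z)^2"
    by (simp add: c1 power_mult_distrib)
  also have "\<dots> \<le> n^2 * ((\<Sum>z \<in> J \<rightarrow>\<^sub>E V. (\<alpha> z)^2) * real (card (J \<rightarrow>\<^sub>E V)))"
    by (intro mult_left_mono sum_squared_le_sum_of_squares) auto
  also have "\<dots> = n ^ card I * (\<Sum>z \<in> J \<rightarrow>\<^sub>E V. (\<alpha> z)^2)"
    unfolding cardJ[symmetric] by (simp only: ac_simps)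
  also have "\<dots> \<le> n ^ card I * real (card (pattern_maps I E V r (\<phi>(i := f))))"
    by (intro mult_left_mono c2) (simp add: n_def)
  finally have "real ((card (pattern_maps I E V r \<phi>))^2)
    \<le> real (card V ^ card I * card (pattern_maps I E V r (\<phi>(i := f))))"
    by (simp add: n_def)
  then show ?thesis by (simp only: of_nat_le_iff)
qed

text \<open>The positions are moved one at a time to indices of their own. Each move at worst
  squares the density, and after \<open>l\<close> moves the pattern is injective, with the density
  of closed walks of length \<open>l\<close>.\<close>

lemma pattern_density_le:
  assumes V: "finite V" "V \<noteq> {}" and irrefl: "\<And>a. (a, a) \<notin> E"
    and sub: "\<And>j. j < l \<Longrightarrow> \<phi> j < m"
  shows "(real (card (pattern_maps {..<m + l} E V l \<phi>)) / real (card V) ^ (m + l)) ^ (2 ^ l)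
    \<le> real (card (closed_walks l E V)) / real (card V) ^ l"
proof -
  define n where "n = real (card V)"
  have n: "n > 0" using V by (simp add: n_def card_gt_0_iff)
  \<comment> \<open>The pattern after \<open>s\<close> moves: position \<open>j < s\<close> sits at
    the fresh index \<open>m + j\<close>.\<close>
  define \<phi>s where "\<phi>s s = (\<lambda>j. if j < s then m + j else \<phi> j)" for s
  define t where "t s = real (card (pattern_maps {..<m + l} E V l (\<phi>s s))) / n ^ (m + l)" for s
  have t0: "t s \<ge> 0" for s using n by (simp add: t_def)
  have step: "(t s)^2 \<le> t (Suc s)" if s: "s < l" for s
  proof -
    have upd: "(\<phi>s s)(s := m + s) = \<phi>s (Suc s)" by (auto simp: \<phi>s_def)
    have "(card (pattern_maps {..<m + l} E V l (\<phi>s s)))^2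
      \<le> card V ^ card {..<m + l} * card (pattern_maps {..<m + l} E V l ((\<phi>s s)(s := m + s)))"
    proof (rule card_pattern_maps_split)
      show "\<phi>s s ` {..<l} \<subseteq> {..<m + l}" using sub by (auto simp: \<phi>s_def intro: trans_less_add1)
      show "m + s \<notin> \<phi>s s ` {..<l}"
      proof
        assume "m + s \<in> \<phi>s s ` {..<l}"
        then obtain j where "j < l" "m + s = \<phi>s s j" by blast
        then show False using sub[of j] by (cases "j < s") (auto simp: \<phi>s_def)
      qed
    qed (use V irrefl s in auto)
    then have "real ((card (pattern_maps {..<m + l} E V l (\<phi>s s)))^2)
      \<le> real (card V ^ (m + l) * card (pattern_maps {..<m + l} E V l (\<phi>s (Suc s))))"
      unfolding upd of_nat_le_iff by simp
    then show ?thesis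
      using n by (simp add: t_def n_def[symmetric] power_divide field_simps power2_eq_square)
  qed
  have "s \<le> l \<Longrightarrow> t 0 ^ (2 ^ s) \<le> t s" for s
  proof (induction s)
    case (Suc s)
    have "t 0 ^ (2 ^ Suc s) = (t 0 ^ (2 ^ s))^2" by (simp add: power_even_eq)
    also have "\<dots> \<le> (t s)^2" using Suc t0 by (intro power_mono) auto
    also have "\<dots> \<le> t (Suc s)" using Suc by (intro step) auto
    finally show ?case .
  qed simp
  from this[of l] have "t 0 ^ (2 ^ l) \<le> t l" by simp
  moreover have "t l = real (card (closed_walks l E V)) / n ^ l"
  proof -
    have "pattern_maps {..<m + l} E V l (\<phi>s l) = pattern_maps {..<m + l} E V l (\<lambda>j. m + j)"
      by (rule pattern_maps_cong) (simp add: \<phi>s_def)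
    moreover have "card (pattern_maps {..<m + l} E V l (\<lambda>j. m + j))
        = card (closed_walks l E V) * card V ^ (card {..<m + l} - l)"
      using V by (intro card_pattern_maps_inj) (auto simp: inj_on_def)
    ultimately show ?thesis
      using n by (simp add: t_def n_def[symmetric] power_add)
  qed
  moreover have "\<phi>s 0 = \<phi>" by (simp add: \<phi>s_def)
  ultimately show ?thesis by (simp add: t_def n_def)
qed

section \<open>Sampling\<close>

text \<open>The number of closed walks of length \<open>k\<close> in a sample is summed over all
  samples. From above, good samples obey the exact bound and bad ones are rare; from below, each
  injective placement of a walk among the \<open>m\<close> indices contributes the density
  \<open>t\<close>.\<close>

lemma closed_walks_density_le:
  assumes k: "k \<ge> 3" and l: "l \<ge> 2 * (k - 1)^2" and d: "d > 0"
    and dmin: "\<And>e. e > 2 \<Longrightarrow> e dvd k \<Longrightarrow> \<not> e dvd l \<Longrightarrow> d \<le> e"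
    and par: "2 dvd k \<Longrightarrow> \<not> 2 dvd l \<Longrightarrow> d \<le> 4"
    and V: "finite V" "V \<noteq> {}"
    and asym: "\<And>a b. (a, b) \<in> E \<Longrightarrow> (b, a) \<notin> E"
    and no_cycle: "\<And>w. w \<in> closed_walks l E V \<Longrightarrow> \<not> inj_on w {..<l}"
    and m: "m > 0" and \<eta>: "\<eta> > 0"
    and large: "real l^2 / real (card V) \<le> \<eta> ^ (2 ^ l)"
  shows "real (card (closed_walks k E V)) / real (card V) ^ k
    \<le> 1 / real d ^ (k - 1) + real m ^ l * \<eta> + real k^2 / real m"
proof -
  define n where "n = real (card V)"
  \<comment> \<open>The first \<open>m\<close> indices form the sample, and the other
    \<open>l\<close> are spare indices for splitting patterns. Samples are drawn with repetition;
    \<open>R x\<close> is the relation pulled back to the indices.\<close>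
  define M where "M = m + l"
  define X where "X = ({..<M} \<rightarrow>\<^sub>E V)"
  define R where "R x = {(i, j). i < m \<and> j < m \<and> (x i, x j) \<in> E}" for x :: "nat \<Rightarrow> 'a"
  define T where "T x = card (closed_walks k (R x) {..<m})" for x
  define t where "t = real (card (closed_walks k E V)) / n ^ k"
  define bad where "bad = {x \<in> X. \<exists>u<m. (u, u) \<in> R x ^^ l}"
  have n: "n > 0" using V by (simp add: n_def card_gt_0_iff)
  have kpos: "k > 0" using k by simp
  have lpos: "l > 0"
  proof -
    have "(k - 1)^2 > 0" using k by simp
    with l show ?thesis by linarith
  qed
  have irrefl: "(a, a) \<notin> E" for a using asym by blast
  have finX: "finite X" unfolding X_def using V by (intro finite_PiE) auto
  have cardX: "real (card X) = n ^ M" by (simp add: X_def card_PiE n_def)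
  have finP: "finite ({..<r} \<rightarrow>\<^sub>E {..<m})" for r :: nat by (intro finite_PiE) auto
  have cardP: "card ({..<r} \<rightarrow>\<^sub>E {..<m}) = m ^ r" for r :: nat by (simp add: card_PiE)
  have t_le: "t \<le> 1"
  proof -
    have "closed_walks k E V \<subseteq> {..<k} \<rightarrow>\<^sub>E V" by (auto simp: closed_walks_def)
    moreover have "finite ({..<k} \<rightarrow>\<^sub>E V)" using V by (intro finite_PiE) auto
    ultimately have "card (closed_walks k E V) \<le> card V ^ k"
      using card_mono[of "{..<k} \<rightarrow>\<^sub>E V" "closed_walks k E V"] by (simp add: card_PiE)
    then have "real (card (closed_walks k E V)) \<le> real (card V ^ k)" by (rule of_nat_mono)
    then show ?thesis using n by (simp add: t_def n_def)
  qed
  \<comment> \<open>All closed walks of length \<open>l\<close> repeat a vertex, so their density is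
    at most \<open>l^2 / n\<close>. Splitting bounds the density of every pattern by the
    \<open>2 ^ l\<close>-th root of this.\<close>
  have pattern_le: "real (card (pattern_maps {..<M} E V l \<phi>)) \<le> \<eta> * n ^ M" if \<phi>: "\<phi> \<in> {..<l} \<rightarrow>\<^sub>E {..<m}" for \<phi>
  proof -
    have "closed_walks l E V \<subseteq> {w \<in> {..<l} \<rightarrow>\<^sub>E V. \<not> inj_on w {..<l}}"
      using no_cycle by (auto simp: closed_walks_def)
    then have "card (closed_walks l E V) \<le> card {w \<in> {..<l} \<rightarrow>\<^sub>E V. \<not> inj_on w {..<l}}"
      by (rule card_mono[rotated]) (use V in \<open>auto intro!: finite_PiE\<close>)
    also have "\<dots> \<le> l^2 * card V ^ (l - 1)" by (rule card_non_injective_le[OF V(1)])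
    finally have "real (card (closed_walks l E V)) \<le> real (l^2 * card V ^ (l - 1))" by (rule of_nat_mono)
    then have "real (card (closed_walks l E V)) / n ^ l \<le> real l^2 * n ^ (l - 1) / n ^ l"
      using n by (simp add: divide_right_mono n_def)
    also have "\<dots> = real l^2 / n" using n lpos by (cases l) auto
    also have "\<dots> \<le> \<eta> ^ (2 ^ l)" using large by (simp add: n_def)
    finally have "real (card (closed_walks l E V)) / n ^ l \<le> \<eta> ^ (2 ^ l)" .
    moreover have "(real (card (pattern_maps {..<M} E V l \<phi>)) / n ^ M) ^ (2 ^ l)
        \<le> real (card (closed_walks l E V)) / n ^ l"
      unfolding M_def n_def by (rule pattern_density_le[OF V irrefl]) (use \<phi> in auto)
    ultimately have "(real (card (pattern_maps {..<M} E V l \<phi>)) / n ^ M) ^ (2 ^ l) \<le> \<eta> ^ (2 ^ l)"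
      by linarith
    then have "real (card (pattern_maps {..<M} E V l \<phi>)) / n ^ M \<le> \<eta>"
      using \<eta> by (subst (asm) power_mono_iff) (use n in auto)
    then show ?thesis using n by (simp add: field_simps)
  qed
  \<comment> \<open>A closed walk of length \<open>l\<close> in the sample is one of
    \<open>m ^ l\<close> patterns, which allows a union bound.\<close>
  have "bad \<subseteq> (\<Union>\<phi> \<in> {..<l} \<rightarrow>\<^sub>E {..<m}. pattern_maps {..<M} E V l \<phi>)"
  proof
    fix x assume "x \<in> bad"
    then obtain u where x: "x \<in> X" and "(u, u) \<in> R x ^^ l" by (auto simp: bad_def)
    then obtain f where f: "f 0 = u" "f l = u" "\<And>i. i < l \<Longrightarrow> (f i, f (Suc i)) \<in> R x"
      unfolding relpow_fun_conv by blast
    have "(f j, f (Suc j mod l)) \<in> R x" if "j < l" for j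
      using f(3)[OF that] f(1,2) that by (cases "Suc j = l") auto
    then have "x \<in> pattern_maps {..<M} E V l (restrict f {..<l})"
      using x by (auto simp: pattern_maps_def X_def R_def)
    moreover have "restrict f {..<l} \<in> {..<l} \<rightarrow>\<^sub>E {..<m}" using f(3) by (auto simp: R_def)
    ultimately show "x \<in> (\<Union>\<phi> \<in> {..<l} \<rightarrow>\<^sub>E {..<m}. pattern_maps {..<M} E V l \<phi>)" by blast
  qed
  then have "card bad \<le> card (\<Union>\<phi> \<in> {..<l} \<rightarrow>\<^sub>E {..<m}. pattern_maps {..<M} E V l \<phi>)"
    by (rule card_mono[rotated]) (use finP V in \<open>auto intro!: finite_pattern_maps\<close>)
  also have "\<dots> \<le> (\<Sum>\<phi> \<in> {..<l} \<rightarrow>\<^sub>E {..<m}. card (pattern_maps {..<M} E V l \<phi>))"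
    by (rule card_UN_le[OF finP])
  finally have "real (card bad) \<le> real (\<Sum>\<phi> \<in> {..<l} \<rightarrow>\<^sub>E {..<m}. card (pattern_maps {..<M} E V l \<phi>))"
    by (rule of_nat_mono)
  also have "\<dots> \<le> (\<Sum>\<phi> \<in> {..<l} \<rightarrow>\<^sub>E {..<m}. \<eta> * n ^ M)"
    unfolding of_nat_sum by (rule sum_mono) (rule pattern_le)
  also have "\<dots> = real m ^ l * (\<eta> * n ^ M)" by (simp add: cardP)
  finally have card_bad: "real (card bad) \<le> real m ^ l * (\<eta> * n ^ M)" .

  have good: "real (T x) \<le> real m * (real m / real d) ^ (k - 1)" if "x \<in> X - bad" for x
  proof -
    have "real (T x) \<le> real (card {..<m}) * (real (card {..<m}) / real d) ^ (k - 1)"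
      unfolding T_def
    proof (rule card_closed_walks_le[OF k l d dmin par])
      show "(b, a) \<notin> R x" if "(a, b) \<in> R x" for a b using asym that by (auto simp: R_def)
      show "(u, u) \<notin> R x ^^ l" if "u \<in> {..<m}" for u
        using that \<open>x \<in> X - bad\<close> by (auto simp: bad_def)
    qed auto
    then show ?thesis by simp
  qed
  have T_le: "real (T x) \<le> real m ^ k" for x
  proof -
    have "T x \<le> card ({..<k} \<rightarrow>\<^sub>E {..<m})"
      unfolding T_def by (rule card_mono[OF finP]) (auto simp: closed_walks_def)
    then have "real (T x) \<le> real (m ^ k)" unfolding cardP by (rule of_nat_mono)
    then show ?thesis by simp
  qed
  have "(\<Sum>x\<in>X. real (T x)) = (\<Sum>x\<in>X - bad. real (T x)) + (\<Sum>x\<in>bad. real (T x))"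
    using finX by (intro sum.subset_diff) (auto simp: bad_def)
  also have "\<dots> \<le> (\<Sum>x\<in>X - bad. real m * (real m / real d) ^ (k - 1)) + (\<Sum>x\<in>bad. real m ^ k)"
    by (intro add_mono sum_mono good T_le)
  also have "\<dots> \<le> n ^ M * (real m * (real m / real d) ^ (k - 1)) + real m ^ l * (\<eta> * n ^ M) * real m ^ k"
  proof (intro add_mono)
    have "real (card (X - bad)) \<le> n ^ M"
      unfolding cardX[symmetric] using finX by (intro of_nat_mono card_mono) auto
    then show "(\<Sum>x\<in>X - bad. real m * (real m / real d) ^ (k - 1)) \<le> n ^ M * (real m * (real m / real d) ^ (k - 1))"
      by (simp add: mult_right_mono)
    show "(\<Sum>x\<in>bad. real m ^ k) \<le> real m ^ l * (\<eta> * n ^ M) * real m ^ k"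
      using card_bad by (simp add: mult_right_mono)
  qed
  also have "real m * (real m / real d) ^ (k - 1) = real m ^ k * (1 / real d ^ (k - 1))"
    using kpos by (cases k) (auto simp: power_divide)
  finally have upper: "(\<Sum>x\<in>X. real (T x)) \<le> n ^ M * real m ^ k * (1 / real d ^ (k - 1) + real m ^ l * \<eta>)"
    by (simp add: algebra_simps)

  \<comment> \<open>Only injective placements are kept, since each of these has exactly the density
    \<open>t\<close>. The double sum over placements and samples is then exchanged.\<close>
  have "(real m ^ k - real k^2 * real m ^ (k - 1)) * (t * n ^ M)
      \<le> real (card {\<phi> \<in> {..<k} \<rightarrow>\<^sub>E {..<m}. inj_on \<phi> {..<k}}) * (t * n ^ M)"
    using card_injective_ge[of "{..<m}" k] kpos n by (intro mult_right_mono) (auto simp: t_def)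
  also have "\<dots> = (\<Sum>\<phi> \<in> {\<phi> \<in> {..<k} \<rightarrow>\<^sub>E {..<m}. inj_on \<phi> {..<k}}. t * n ^ M)" by simp
  also have "\<dots> = (\<Sum>\<phi> \<in> {\<phi> \<in> {..<k} \<rightarrow>\<^sub>E {..<m}. inj_on \<phi> {..<k}}. real (card (pattern_maps {..<M} E V k \<phi>)))"
  proof (rule sum.cong[OF refl])
    fix \<phi> assume "\<phi> \<in> {\<phi> \<in> {..<k} \<rightarrow>\<^sub>E {..<m}. inj_on \<phi> {..<k}}"
    then have \<phi>: "\<phi> ` {..<k} \<subseteq> {..<m}" "inj_on \<phi> {..<k}" by auto
    have "k \<le> m" using card_inj_on_le[OF \<phi>(2,1)] by simp
    then have kM: "M = (M - k) + k" by (simp add: M_def)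
    have "card (pattern_maps {..<M} E V k \<phi>) = card (closed_walks k E V) * card V ^ (card {..<M} - k)"
      using V \<phi> by (intro card_pattern_maps_inj) (auto simp: M_def)
    then have "real (card (pattern_maps {..<M} E V k \<phi>)) = t * n ^ k * n ^ (M - k)"
      using n by (simp add: t_def n_def)
    also have "\<dots> = t * n ^ M" by (subst (2) kM) (simp add: power_add)
    finally show "t * n ^ M = real (card (pattern_maps {..<M} E V k \<phi>))" by simp
  qed
  also have "\<dots> \<le> (\<Sum>\<phi> \<in> {..<k} \<rightarrow>\<^sub>E {..<m}. real (card (pattern_maps {..<M} E V k \<phi>)))"
    by (rule sum_mono2[OF finP]) auto
  also have "\<dots> = real (\<Sum>\<phi> \<in> {..<k} \<rightarrow>\<^sub>E {..<m}. card {x \<in> X. \<forall>j<k. (x (\<phi> j), x (\<phi> (Suc j mod k))) \<in> E})"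
    by (simp add: pattern_maps_def X_def)
  also have "\<dots> = real (\<Sum>x\<in>X. card {\<phi> \<in> {..<k} \<rightarrow>\<^sub>E {..<m}. \<forall>j<k. (x (\<phi> j), x (\<phi> (Suc j mod k))) \<in> E})"
    by (subst sum_card_swap[OF finP finX]) (rule refl)
  also have "\<dots> = (\<Sum>x\<in>X. real (T x))"
    unfolding of_nat_sum
  proof (rule sum.cong[OF refl])
    fix x
    have "\<phi> j < m \<and> \<phi> (Suc j mod k) < m" if "\<phi> \<in> {..<k} \<rightarrow>\<^sub>E {..<m}" "j < k" for \<phi> j
      using that kpos PiE_mem[OF that(1), of j] PiE_mem[OF that(1), of "Suc j mod k"] by auto
    then have "{\<phi> \<in> {..<k} \<rightarrow>\<^sub>E {..<m}. \<forall>j<k. (x (\<phi> j), x (\<phi> (Suc j mod k))) \<in> E} = closed_walks k (R x) {..<m}"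
      by (auto simp: closed_walks_def R_def)
    then show "real (card {\<phi> \<in> {..<k} \<rightarrow>\<^sub>E {..<m}. \<forall>j<k. (x (\<phi> j), x (\<phi> (Suc j mod k))) \<in> E}) = real (T x)"
      by (simp only: T_def)
  qed
  also note upper
  finally have "(real m ^ k - real k^2 * real m ^ (k - 1)) * t * n ^ M
      \<le> (real m ^ k * (1 / real d ^ (k - 1) + real m ^ l * \<eta>)) * n ^ M"
    by (simp only: ac_simps)
  then have "(real m ^ k - real k^2 * real m ^ (k - 1)) * t
      \<le> real m ^ k * (1 / real d ^ (k - 1) + real m ^ l * \<eta>)" using n by simp
  moreover have "real m ^ k - real k^2 * real m ^ (k - 1) = real m ^ k * (1 - real k^2 / real m)"
    using m kpos by (cases k) (auto simp: field_simps)
  ultimately have "(1 - real k^2 / real m) * t \<le> 1 / real d ^ (k - 1) + real m ^ l * \<eta>"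
    using m by (simp add: mult.assoc)
  \<comment> \<open>The trivial bound \<open>t \<le> 1\<close> turns the relative loss from
    non-injective placements into an additive error.\<close>
  moreover have "real k^2 / real m * t \<le> real k^2 / real m * 1"
    using t_le by (intro mult_left_mono) auto
  ultimately have "t \<le> 1 / real d ^ (k - 1) + real m ^ l * \<eta> + real k^2 / real m"
    unfolding left_diff_distrib by linarith
  then show ?thesis by (simp only: t_def n_def)
qed

section \<open>Copies of directed cycles\<close>

definition cycle_graph :: "nat \<Rightarrow> (nat \<Rightarrow> 'a) \<Rightarrow> 'a pair_pre_digraph" where
  "cycle_graph k w = \<lparr>pverts = w ` {..<k}, parcs = {(w i, w (Suc i mod k)) | i. i < k}\<rparr>"

text \<open>Directed cycles of \<open>G\<close> with a chosen starting vertex.\<close>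

definition injective_closed_walks :: "nat \<Rightarrow> 'a pair_pre_digraph \<Rightarrow> (nat \<Rightarrow> 'a) set" where
  "injective_closed_walks k G = {w \<in> closed_walks k (parcs G) (pverts G). inj_on w {..<k}}"

lemma parcs_directed_cycle: "parcs (directed_cycle k) = {(i, Suc i mod k) | i. i < k}"
  by (simp add: directed_cycle_def)

text \<open>The inverse of an isomorphism onto the directed cycle is an injective closed walk
  tracing the copy, and conversely the inverse of such a walk is an isomorphism.\<close>

lemma copies_directed_cycle:
  assumes "pair_wf_digraph G" and k: "k > 0"
  shows "copies (directed_cycle k) G = cycle_graph k ` injective_closed_walks k G"
proof
  have sk: "Suc i mod k < k" for i using k by simp
  show "copies (directed_cycle k) G \<subseteq> cycle_graph k ` injective_closed_walks k G"
  proof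
    fix S assume "S \<in> copies (directed_cycle k) G"
    then obtain f where sub: "pverts S \<subseteq> pverts G" "parcs S \<subseteq> parcs G"
      and iso: "pre_digraph.digraph_isomorphism (with_proj S) f"
      and app: "with_proj (directed_cycle k) = app_iso f (with_proj S)"
      by (auto simp: copies_def subgraph_def digraph_iso_def)
    define h where "h = iso_verts f"
    have wf: "wf_digraph (with_proj S)" and inj: "inj_on h (pverts S)"
      using iso by (simp_all add: pre_digraph.digraph_isomorphism_def h_def)
    have hS: "h ` pverts S = {..<k}"
      using arg_cong[OF app, of verts] by (simp add: h_def directed_cycle_def)
    have arcs: "iso_arcs f ` parcs S = {(i, Suc i mod k) | i. i < k}"
      using arg_cong[OF app, of arcs] by (simp add: parcs_directed_cycle)
    have tl: "iso_tail f = fst" and hd: "iso_head f = snd"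
      using arg_cong[OF app, of tail] arg_cong[OF app, of head] by simp_all
    \<comment> \<open>Both graphs have the projections as tail and head, so the vertex map
      determines the arc map.\<close>
    have iso_arc: "iso_arcs f (a, b) = (h a, h b)" if "(a, b) \<in> parcs S" for a b
      using iso that tl hd
      by (force simp: pre_digraph.digraph_isomorphism_def h_def intro: prod_eqI)
    have ends: "a \<in> pverts S" "b \<in> pverts S" if "(a, b) \<in> parcs S" for a b
      using wf_digraph.tail_in_verts[OF wf, of "(a, b)"] wf_digraph.head_in_verts[OF wf, of "(a, b)"] that
      by auto
    define w where "w = (\<lambda>i\<in>{..<k}. the_inv_into (pverts S) h i)"
    have wh: "w (h a) = a" if "a \<in> pverts S" for a
      using that hS inj by (auto simp: w_def the_inv_into_f_f)
    have hw: "h (w i) = i" "w i \<in> pverts S" if "i < k" for i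
      using that hS inj f_the_inv_into_f[OF inj, of i] the_inv_into_into[OF inj, of i "pverts S"]
      by (auto simp: w_def)
    have w_inj: "inj_on w {..<k}" by (rule inj_on_inverseI[of _ h]) (use hw in auto)
    have w_img: "w ` {..<k} = pverts S"
    proof
      show "pverts S \<subseteq> w ` {..<k}"
      proof
        fix a assume "a \<in> pverts S"
        then show "a \<in> w ` {..<k}" using wh hS by (intro image_eqI[of _ _ "h a"]) auto
      qed
    qed (use hw in auto)
    have w_arc: "(w i, w (Suc i mod k)) \<in> parcs S" if i: "i < k" for i
    proof -
      have "(i, Suc i mod k) \<in> iso_arcs f ` parcs S" using i arcs by auto
      then obtain a b where ab: "(a, b) \<in> parcs S" "(i, Suc i mod k) = iso_arcs f (a, b)" by auto
      then have "h a = i" "h b = Suc i mod k" using iso_arc[OF ab(1)] by auto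
      then have "a = w i" "b = w (Suc i mod k)" using wh ends[OF ab(1)] by metis+
      then show ?thesis using ab(1) by simp
    qed
    have arc_w: "\<exists>i<k. (a, b) = (w i, w (Suc i mod k))" if ab: "(a, b) \<in> parcs S" for a b
    proof -
      have "(h a, h b) \<in> {(i, Suc i mod k) | i. i < k}"
        using ab arcs iso_arc[OF ab] by force
      then have ha: "h a < k" and hb: "h b = Suc (h a) mod k" by auto
      have "w (h a) = a" "w (Suc (h a) mod k) = b" using wh ends[OF ab] unfolding hb[symmetric] by auto
      then show ?thesis using ha by (intro exI[of _ "h a"]) auto
    qed
    have "S = cycle_graph k w"
    proof (rule pair_pre_digraph.equality)
      show "parcs S = parcs (cycle_graph k w)"
        using w_arc arc_w by (fastforce simp: cycle_graph_def)
    qed (simp_all add: cycle_graph_def w_img)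
    moreover have "w \<in> injective_closed_walks k G"
    proof -
      have "w \<in> {..<k} \<rightarrow>\<^sub>E pverts G" using hw(2) sub(1) by (auto simp: w_def)
      then show ?thesis using w_arc sub(2) w_inj by (auto simp: injective_closed_walks_def closed_walks_def)
    qed
    ultimately show "S \<in> cycle_graph k ` injective_closed_walks k G" by blast
  qed
  show "cycle_graph k ` injective_closed_walks k G \<subseteq> copies (directed_cycle k) G"
  proof
    fix S assume "S \<in> cycle_graph k ` injective_closed_walks k G"
    then obtain w where w: "w \<in> {..<k} \<rightarrow>\<^sub>E pverts G" "\<And>i. i < k \<Longrightarrow> (w i, w (Suc i mod k)) \<in> parcs G"
      "inj_on w {..<k}" and S: "S = cycle_graph k w"
      by (auto simp: injective_closed_walks_def closed_walks_def)
    define h where "h = the_inv_into {..<k} w"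
    have hw: "h (w i) = i" if "i < k" for i using that w(3) by (simp add: h_def the_inv_into_f_f)
    have "pair_wf_digraph S"
      by unfold_locales (use sk in \<open>auto simp: S cycle_graph_def\<close>)
    then have wfS: "wf_digraph (with_proj S)" by (simp add: wf_digraph_wp_iff)
    have wfG: "wf_digraph (with_proj G)" using assms(1) by (simp add: wf_digraph_wp_iff)
    have "subgraph (with_proj S) (with_proj G)"
      unfolding subgraph_def using wfS wfG w by (auto simp: S cycle_graph_def)
    moreover have "digraph_iso (with_proj S) (with_proj (directed_cycle k))"
      unfolding digraph_iso_def
    proof (intro exI conjI)
      let ?f = "\<lparr>iso_verts = h, iso_arcs = map_prod h h, iso_head = snd, iso_tail = fst\<rparr>"
      have inj: "inj_on h (pverts S)"
        by (rule inj_on_inverseI[of _ w]) (use hw in \<open>auto simp: S cycle_graph_def\<close>)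
      have "parcs S \<subseteq> pverts S \<times> pverts S" using sk by (auto simp: S cycle_graph_def)
      then have "inj_on (map_prod h h) (parcs S)"
        by (rule inj_on_subset[OF map_prod_inj_on[OF inj inj]])
      then show "pre_digraph.digraph_isomorphism (with_proj S) ?f"
        using wfS inj by (auto simp: pre_digraph.digraph_isomorphism_def)
      have "h ` pverts S = {..<k}" using hw by (force simp: S cycle_graph_def)
      moreover have "map_prod h h ` parcs S = parcs (directed_cycle k)"
      proof
        show "map_prod h h ` parcs S \<subseteq> parcs (directed_cycle k)"
          using hw sk by (auto simp: S cycle_graph_def parcs_directed_cycle)
        show "parcs (directed_cycle k) \<subseteq> map_prod h h ` parcs S"
        proof
          fix e assume "e \<in> parcs (directed_cycle k)"
          then obtain i where i: "i < k" "e = (i, Suc i mod k)" by (auto simp: parcs_directed_cycle)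
          show "e \<in> map_prod h h ` parcs S"
            by (rule image_eqI[of _ _ "(w i, w (Suc i mod k))"])
              (use i hw sk in \<open>auto simp: S cycle_graph_def\<close>)
        qed
      qed
      ultimately show "with_proj (directed_cycle k) = app_iso ?f (with_proj S)"
        by (intro pre_digraph.equality) (auto simp: directed_cycle_def)
    qed
    ultimately show "S \<in> copies (directed_cycle k) G" by (simp add: copies_def)
  qed
qed

text \<open>A walk tracing the same cycle starts at some \<open>w r\<close>. By injectivity each
  vertex has a unique successor on the cycle, so the walk is the rotation by \<open>r\<close>, and
  the \<open>k\<close> rotations are distinct.\<close>

lemma card_cycle_graph_fibre:
  assumes w: "w \<in> injective_closed_walks k G" and k: "k > 0"
  shows "card {w' \<in> injective_closed_walks k G. cycle_graph k w' = cycle_graph k w} = k"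
proof -
  define rot where "rot r = (\<lambda>i\<in>{..<k}. w ((i + r) mod k))" for r
  have wc: "w \<in> closed_walks k (parcs G) (pverts G)" and inj: "inj_on w {..<k}"
    using w by (auto simp: injective_closed_walks_def)
  have inj_iff: "w (i mod k) = w (j mod k) \<longleftrightarrow> i mod k = j mod k" for i j
    using inj k by (auto simp: inj_on_eq_iff)
  have rot_inj: "inj_on (rot r) {..<k}" for r
  proof
    fix i j assume ij: "i \<in> {..<k}" "j \<in> {..<k}" "rot r i = rot r j"
    then have "(i + r) mod k = (j + r) mod k" by (simp add: rot_def inj_iff)
    with ij(1,2) show "i = j"
      using bij_betw_imp_inj_on[OF bij_betw_add_mod[OF k, of r]] by (auto dest: inj_onD)
  qed
  have rot_graph: "cycle_graph k (rot r) = cycle_graph k w" for r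
  proof -
    have a: "(rot r i, rot r (Suc i mod k)) = (w ((i + r) mod k), w (Suc ((i + r) mod k) mod k))" if "i < k" for i
      using that k by (simp add: rot_def mod_simps)
    have "{(rot r i, rot r (Suc i mod k)) | i. i < k} = {(w i, w (Suc i mod k)) | i. i < k}"
    proof (intro equalityI subsetI)
      fix e assume "e \<in> {(rot r i, rot r (Suc i mod k)) | i. i < k}"
      then obtain i where "i < k" "e = (rot r i, rot r (Suc i mod k))" by blast
      then show "e \<in> {(w i, w (Suc i mod k)) | i. i < k}"
        using k by (intro CollectI exI[of _ "(i + r) mod k"]) (simp add: a)
    next
      fix e assume "e \<in> {(w i, w (Suc i mod k)) | i. i < k}"
      then obtain j where j: "j < k" "e = (w j, w (Suc j mod k))" by blast
      obtain i where i: "i < k" "(i + r) mod k = j" using mod_add_surj[OF j(1)] by blast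
      have "e = (rot r i, rot r (Suc i mod k))" unfolding a[OF i(1)] i(2) by (rule j(2))
      then show "e \<in> {(rot r i, rot r (Suc i mod k)) | i. i < k}" using i(1) by blast
    qed
    moreover have "rot r ` {..<k} = w ` {..<k}"
    proof (intro equalityI subsetI)
      fix v assume "v \<in> w ` {..<k}"
      then obtain j where j: "j < k" "v = w j" by blast
      obtain i where "i < k" "(i + r) mod k = j" using mod_add_surj[OF j(1)] by blast
      then show "v \<in> rot r ` {..<k}" using j by (intro image_eqI[of _ _ i]) (auto simp: rot_def)
    qed (use k in \<open>auto simp: rot_def\<close>)
    ultimately show ?thesis by (simp only: cycle_graph_def)
  qed
  have "{w' \<in> injective_closed_walks k G. cycle_graph k w' = cycle_graph k w} = rot ` {..<k}"
  proof (intro equalityI subsetI)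
    fix w' assume "w' \<in> {w' \<in> injective_closed_walks k G. cycle_graph k w' = cycle_graph k w}"
    then have w': "w' \<in> {..<k} \<rightarrow>\<^sub>E pverts G" "cycle_graph k w' = cycle_graph k w"
      by (auto simp: injective_closed_walks_def closed_walks_def)
    have "w' ` {..<k} = w ` {..<k}"
      using arg_cong[OF w'(2), of pverts] by (simp add: cycle_graph_def)
    then have "w' 0 \<in> w ` {..<k}" using k by blast
    then obtain r where r: "r < k" "w' 0 = w r" by blast
    have arcs: "{(w' i, w' (Suc i mod k)) | i. i < k} = {(w i, w (Suc i mod k)) | i. i < k}"
      using arg_cong[OF w'(2), of parcs] by (simp add: cycle_graph_def)
    have "i < k \<Longrightarrow> w' i = w ((i + r) mod k)" for i
    proof (induction i)
      case 0
      then show ?case using r by simp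
    next
      case (Suc i)
      have "(w' i, w' (Suc i mod k)) \<in> {(w i, w (Suc i mod k)) | i. i < k}"
        unfolding arcs[symmetric] using Suc.prems by (intro CollectI exI[of _ i]) auto
      then obtain j where j: "j < k" "w' i = w j" "w' (Suc i) = w (Suc j mod k)"
        using Suc.prems by auto
      then have "j = (i + r) mod k" using Suc inj_iff[of j "i + r"] by simp
      then show ?case using j(3) by (simp add: mod_simps)
    qed
    then have "w' = rot r"
      using w'(1) by (intro extensionalityI[of _ "{..<k}"]) (auto simp: rot_def PiE_def)
    then show "w' \<in> rot ` {..<k}" using r(1) by blast
  next
    fix w' assume "w' \<in> rot ` {..<k}"
    then obtain r where r: "w' = rot r" by blast
    have "rot r \<in> closed_walks k (parcs G) (pverts G)"
      unfolding rot_def by (rule rotate_closed_walk[OF wc k])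
    then show "w' \<in> {w' \<in> injective_closed_walks k G. cycle_graph k w' = cycle_graph k w}"
      using rot_inj rot_graph by (simp add: r injective_closed_walks_def)
  qed
  moreover have "inj_on rot {..<k}"
  proof
    fix r s assume rs: "r \<in> {..<k}" "s \<in> {..<k}" "rot r = rot s"
    then have "rot r 0 = rot s 0" by simp
    then have "w (r mod k) = w (s mod k)" using k by (simp add: rot_def)
    then show "r = s" using rs inj_iff by simp
  qed
  ultimately show ?thesis by (simp add: card_image)
qed

lemma card_copies_directed_cycle:
  assumes "oriented_graph G" and k: "k > 0"
  shows "k * card (copies (directed_cycle k) G) = card (injective_closed_walks k G)"
proof -
  interpret oriented_graph G by fact
  have fin: "finite (injective_closed_walks k G)"
    by (simp add: injective_closed_walks_def finite_closed_walks pair_finite_verts)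
  have "card (injective_closed_walks k G)
      = (\<Sum>S \<in> cycle_graph k ` injective_closed_walks k G.
           card {w \<in> injective_closed_walks k G. cycle_graph k w = S})"
    using sum.image_gen[OF fin, of "\<lambda>_. 1 :: nat" "cycle_graph k"] by simp
  also have "\<dots> = (\<Sum>S \<in> cycle_graph k ` injective_closed_walks k G. k)"
    by (rule sum.cong[OF refl]) (auto simp: card_cycle_graph_fibre k)
  also have "\<dots> = k * card (copies (directed_cycle k) G)"
    by (simp add: copies_directed_cycle[OF _ k] pair_wf_digraph_axioms)
  finally show ?thesis ..
qed

section \<open>The extremal number\<close>

lemma card_copies_directed_cycle_le:
  assumes G: "oriented_graph G" and n: "card (pverts G) = n" "n > 0" and free: "copies (directed_cycle l) G = {}"
    and k: "k \<ge> 3" and l: "l \<ge> 2 * (k - 1)^2" and d: "d > 0"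
    and dmin: "\<And>e. e > 2 \<Longrightarrow> e dvd k \<Longrightarrow> \<not> e dvd l \<Longrightarrow> d \<le> e"
    and par: "2 dvd k \<Longrightarrow> \<not> 2 dvd l \<Longrightarrow> d \<le> 4"
    and m: "m > 0" and \<eta>: "\<eta> > 0" and large: "real l^2 / real n \<le> \<eta> ^ (2 ^ l)"
  shows "real k * real (card (copies (directed_cycle k) G))
    \<le> real n ^ k * (1 / real d ^ (k - 1) + real m ^ l * \<eta> + real k^2 / real m)"
proof -
  interpret oriented_graph G by fact
  have kpos: "k > 0" using k by simp
  have lpos: "l > 0"
  proof -
    have "(k - 1)^2 > 0" using k by simp
    with l show ?thesis by linarith
  qed
  have V: "finite (pverts G)" "pverts G \<noteq> {}" using n by (auto simp: pair_finite_verts)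
  have no_cycle: "\<not> inj_on w {..<l}" if "w \<in> closed_walks l (parcs G) (pverts G)" for w
  proof
    assume "inj_on w {..<l}"
    with that have "cycle_graph l w \<in> copies (directed_cycle l) G"
      using copies_directed_cycle[OF pair_wf_digraph_axioms lpos] by (auto simp: injective_closed_walks_def)
    with free show False by simp
  qed
  have "real k * real (card (copies (directed_cycle k) G)) = real (card (injective_closed_walks k G))"
    using card_copies_directed_cycle[OF G kpos] by (metis of_nat_mult)
  also have "\<dots> \<le> real (card (closed_walks k (parcs G) (pverts G)))"
    using finite_closed_walks[OF V(1)] by (intro of_nat_mono card_mono) (auto simp: injective_closed_walks_def)
  also have "\<dots> \<le> real n ^ k * (1 / real d ^ (k - 1) + real m ^ l * \<eta> + real k^2 / real m)"
  proof -
    have "real (card (closed_walks k (parcs G) (pverts G))) / real (card (pverts G)) ^ k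
        \<le> 1 / real d ^ (k - 1) + real m ^ l * \<eta> + real k^2 / real m"
      by (rule closed_walks_density_le[OF k l d dmin par V at_most_one_arc no_cycle m \<eta>])
        (use large n in auto)
    then show ?thesis using n by (simp add: pos_divide_le_eq mult.commute)
  qed
  finally show ?thesis .
qed

section \<open>The balanced blow-up of a directed cycle\<close>

definition cycle_blowup :: "nat \<Rightarrow> nat \<Rightarrow> nat pair_pre_digraph" where
  "cycle_blowup d n = \<lparr>pverts = {..<n}, parcs = {(a, b). a < n \<and> b < n \<and> b mod d = Suc a mod d}\<rparr>"

text \<open>Every arc raises the residue modulo \<open>d\<close> by one, so closed walks have
  lengths divisible by \<open>d\<close>. This rules out loops and opposite arcs when
  \<open>d > 2\<close>, and cycles of length \<open>l\<close> when \<open>d\<close> does not divide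
  \<open>l\<close>.\<close>

lemma cycle_blowup_relpow:
  assumes "(a, b) \<in> parcs (cycle_blowup d n) ^^ i"
  shows "b mod d = (a + i) mod d"
  using assms
proof (induction i arbitrary: b)
  case (Suc i)
  then obtain c where c: "(a, c) \<in> parcs (cycle_blowup d n) ^^ i" "(c, b) \<in> parcs (cycle_blowup d n)"
    by auto
  then have "b mod d = Suc (c mod d) mod d" by (simp add: cycle_blowup_def mod_Suc_eq)
  then show ?case using Suc.IH[OF c(1)] by (simp add: mod_Suc_eq)
qed simp

lemma oriented_graph_cycle_blowup:
  assumes "d > 2"
  shows "oriented_graph (cycle_blowup d n)"
proof
  have ne: "Suc a mod d \<noteq> a mod d" for a
    using assms by (auto simp: mod_Suc)
  show "finite (pverts (cycle_blowup d n))" by (simp add: cycle_blowup_def)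
  show "finite (parcs (cycle_blowup d n))"
    by (rule finite_subset[of _ "{..<n} \<times> {..<n}"]) (auto simp: cycle_blowup_def)
  fix e assume "e \<in> parcs (cycle_blowup d n)"
  then show "fst e \<in> pverts (cycle_blowup d n)" "snd e \<in> pverts (cycle_blowup d n)" "fst e \<noteq> snd e"
    using ne[of "fst e"] by (auto simp: cycle_blowup_def)
next
  fix u v assume uv: "(u, v) \<in> parcs (cycle_blowup d n)"
  show "(v, u) \<notin> parcs (cycle_blowup d n)"
  proof
    assume "(v, u) \<in> parcs (cycle_blowup d n)"
    with uv have "(u, u) \<in> parcs (cycle_blowup d n) ^^ 2"
      by (auto simp: numeral_2_eq_2)
    then have "u mod d = (u + 2) mod d" by (rule cycle_blowup_relpow)
    then have "int d dvd int (u + 2) - int u" by (metis mod_eq_dvd_iff zmod_int)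
    then have "int d dvd int 2" by simp
    then have "d dvd 2" by (simp only: of_nat_dvd_iff)
    then show False using assms by (auto dest: dvd_imp_le)
  qed
qed

lemma copies_cycle_blowup:
  assumes "d > 2" "\<not> d dvd l" "l > 0"
  shows "copies (directed_cycle l) (cycle_blowup d n) = {}"
proof -
  interpret oriented_graph "cycle_blowup d n" by (rule oriented_graph_cycle_blowup[OF assms(1)])
  have "w \<notin> closed_walks l (parcs (cycle_blowup d n)) (pverts (cycle_blowup d n))" for w
  proof
    assume "w \<in> closed_walks l (parcs (cycle_blowup d n)) (pverts (cycle_blowup d n))"
    from closed_walks_relpow[OF this assms(3), of 0 l]
    have "w 0 mod d = (w 0 + l) mod d" by (intro cycle_blowup_relpow) simp
    then have "int d dvd int (w 0 + l) - int (w 0)" by (metis mod_eq_dvd_iff zmod_int)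
    then show False using assms(2) by simp
  qed
  then have "injective_closed_walks l (cycle_blowup d n) = {}"
    by (auto simp: injective_closed_walks_def)
  then show ?thesis
    by (simp add: copies_directed_cycle[OF pair_wf_digraph_axioms assms(3)])
qed

lemma card_closed_walks_cycle_blowup_ge:
  assumes d: "d > 2" and dk: "d dvd k" and k: "k > 0"
  shows "card (closed_walks k (parcs (cycle_blowup d n)) {..<n}) \<ge> d * (n div d) ^ k"
proof -
  define q where "q = n div d"
  \<comment> \<open>A walk is chosen by its starting class \<open>c\<close> and, for each step, one
    of the first \<open>n div d\<close> members of the class \<open>(c + i) mod d\<close>. It closes
    up because \<open>d\<close> divides \<open>k\<close>.\<close>
  define h where "h = (\<lambda>(c, y). (\<lambda>i\<in>{..<k}. d * y i + (c + i) mod d))"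
  define D where "D = {..<d} \<times> ({..<k} \<rightarrow>\<^sub>E {..<q})"
  have inj: "inj_on h D"
  proof
    fix p p' assume "p \<in> D" "p' \<in> D" and eq: "h p = h p'"
    then obtain c y c' y' where p: "p = (c, y)" "p' = (c', y')" "c < d" "c' < d"
      "y \<in> {..<k} \<rightarrow>\<^sub>E {..<q}" "y' \<in> {..<k} \<rightarrow>\<^sub>E {..<q}" by (auto simp: D_def)
    have e: "d * y i + (c + i) mod d = d * y' i + (c' + i) mod d" if "i < k" for i
      using fun_cong[OF eq, of i] that by (simp add: h_def p)
    have "(d * y 0 + (c + 0) mod d) mod d = (d * y' 0 + (c' + 0) mod d) mod d" using e[OF k] by simp
    then have "c = c'" using p by simp
    moreover have "y = y'"
    proof (rule extensionalityI[of _ "{..<k}"])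
      fix i assume "i \<in> {..<k}"
      then show "y i = y' i" using e[of i] d \<open>c = c'\<close> by simp
    qed (use p in \<open>auto simp: PiE_def\<close>)
    ultimately show "p = p'" by (simp add: p)
  qed
  have sub: "h ` D \<subseteq> closed_walks k (parcs (cycle_blowup d n)) {..<n}"
  proof
    fix w assume "w \<in> h ` D"
    then obtain c y where w: "w = h (c, y)" "c < d" "y \<in> {..<k} \<rightarrow>\<^sub>E {..<q}" by (auto simp: D_def)
    have wi: "w i = d * y i + (c + i) mod d" if "i < k" for i using that by (simp add: w h_def)
    have lt: "w i < n" if "i < k" for i
    proof -
      have "y i < q" using w(3) that by auto
      then have "d * Suc (y i) \<le> d * q" by (intro mult_le_mono2) simp
      also have "\<dots> \<le> n" by (simp add: q_def)
      finally have "d * y i + d \<le> n" by simp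
      moreover have "(c + i) mod d < d" using d by simp
      ultimately show ?thesis unfolding wi[OF that] by linarith
    qed
    have "(w i, w (Suc i mod k)) \<in> parcs (cycle_blowup d n)" if i: "i < k" for i
    proof -
      have s: "Suc i mod k < k" using k by simp
      have "w (Suc i mod k) mod d = (c + Suc i mod k) mod d" using wi[OF s] by simp
      also have "\<dots> = (c + Suc i mod k mod d) mod d" by (simp add: mod_simps)
      also have "Suc i mod k mod d = Suc i mod d" using dk by (rule mod_mod_cancel)
      also have "(c + Suc i mod d) mod d = Suc (w i) mod d"
        unfolding wi[OF i] by (simp add: mod_simps)
      finally show ?thesis using lt[OF i] lt[OF s] by (simp add: cycle_blowup_def)
    qed
    moreover have "w \<in> {..<k} \<rightarrow>\<^sub>E {..<n}" using lt by (auto simp: w h_def)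
    ultimately show "w \<in> closed_walks k (parcs (cycle_blowup d n)) {..<n}" by (simp add: closed_walks_def)
  qed
  have "card D \<le> card (closed_walks k (parcs (cycle_blowup d n)) {..<n})"
    by (rule card_inj_on_le[OF inj sub]) (simp add: finite_closed_walks)
  then show ?thesis by (simp add: D_def card_cartesian_product card_PiE q_def)
qed

text \<open>Two losses of order \<open>n ^ (k - 1)\<close> occur: rounding \<open>n / d\<close>
  down, estimated by Bernoulli's inequality, gives the term with \<open>k * d\<close>, and
  discarding non-injective closed walks gives the term with \<open>k^2\<close>.\<close>

lemma card_copies_cycle_blowup_ge:
  assumes d: "d > 2" and dk: "d dvd k" and k: "k > 0" and n: "n \<ge> d"
  shows "real k * real (card (copies (directed_cycle k) (cycle_blowup d n)))
    \<ge> real n ^ k / real d ^ (k - 1) - real (k * d + k^2) * real n ^ (k - 1)"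
proof -
  let ?G = "cycle_blowup d n"
  have npos: "n > 0" using d n by simp
  obtain j where j: "k = Suc j" using k by (cases k) auto
  have pv: "pverts ?G = {..<n}" by (simp add: cycle_blowup_def)
  have fin: "finite (closed_walks k (parcs ?G) {..<n})" by (simp add: finite_closed_walks)
  have "closed_walks k (parcs ?G) {..<n}
      \<subseteq> injective_closed_walks k ?G \<union> {w \<in> {..<k} \<rightarrow>\<^sub>E {..<n}. \<not> inj_on w {..<k}}"
    by (auto simp: injective_closed_walks_def pv closed_walks_def)
  then have "card (closed_walks k (parcs ?G) {..<n})
      \<le> card (injective_closed_walks k ?G \<union> {w \<in> {..<k} \<rightarrow>\<^sub>E {..<n}. \<not> inj_on w {..<k}})"
    by (rule card_mono[rotated]) (auto simp: injective_closed_walks_def pv fin intro!: finite_PiE)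
  also have "\<dots> \<le> card (injective_closed_walks k ?G) + card {w \<in> {..<k} \<rightarrow>\<^sub>E {..<n}. \<not> inj_on w {..<k}}"
    by (rule card_Un_le)
  also have "\<dots> \<le> card (injective_closed_walks k ?G) + k^2 * n ^ (k - 1)"
    using card_non_injective_le[of "{..<n}" k] by simp
  also have "card (injective_closed_walks k ?G) = k * card (copies (directed_cycle k) ?G)"
    by (rule card_copies_directed_cycle[OF oriented_graph_cycle_blowup[OF d] k, symmetric])
  finally have "d * (n div d) ^ k \<le> k * card (copies (directed_cycle k) ?G) + k^2 * n ^ (k - 1)"
    using card_closed_walks_cycle_blowup_ge[OF d dk k, of n] by linarith
  then have "real (d * (n div d) ^ k) \<le> real (k * card (copies (directed_cycle k) ?G) + k^2 * n ^ (k - 1))"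
    by (rule of_nat_mono)
  then have count: "real d * real (n div d) ^ k
      \<le> real k * real (card (copies (directed_cycle k) ?G)) + real k^2 * real n ^ (k - 1)" by simp
  have "real n ^ k / real d ^ (k - 1) - real k * real d * real n ^ (k - 1)
      \<le> real n ^ k / real d ^ (k - 1) - real k * real n ^ (k - 1) * (real d / real d ^ (k - 1))"
  proof -
    have "real d / real d ^ (k - 1) \<le> real d / 1"
      using d by (intro divide_left_mono one_le_power) auto
    then have "real k * real n ^ (k - 1) * (real d / real d ^ (k - 1)) \<le> real k * real n ^ (k - 1) * (real d / 1)"
      by (rule mult_left_mono) simp
    then show ?thesis by (simp add: ac_simps)
  qed
  also have "\<dots> = real d * (real n / real d) ^ k * (1 + real k * (- (real d / real n)))"
    using npos d by (simp add: j power_divide field_simps)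
  \<comment> \<open>Bernoulli's inequality requires \<open>- (d / n)\<close> to be at least
    \<open>- 1\<close>, which is \<open>n \<ge> d\<close>.\<close>
  also have "\<dots> \<le> real d * (real n / real d) ^ k * (1 + - (real d / real n)) ^ k"
    using n npos by (intro mult_left_mono Bernoulli_inequality) auto
  also have "\<dots> = real d * (real n / real d - 1) ^ k"
    using npos d by (simp add: power_mult_distrib[symmetric] algebra_simps)
  also have "\<dots> \<le> real d * real (n div d) ^ k"
  proof (intro mult_left_mono power_mono)
    have "n = d * (n div d) + n mod d" by simp
    moreover have "n mod d < d" using d by simp
    ultimately have "n \<le> d * (n div d) + d" by linarith
    then have "real n \<le> real (d * (n div d) + d)" by (rule of_nat_mono)
    then show "real n / real d - 1 \<le> real (n div d)" using d by (simp add: field_simps)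
  qed (use n d in auto)
  finally show ?thesis using count by (simp add: algebra_simps)
qed

theorem theorem3p4:
  fixes k l d :: nat
  assumes "k \<ge> 3"
    and "l \<ge> 2 * (k - 1)^2"
    and "\<not> k dvd l"
    and "d = (LEAST e. e > 2 \<and> e dvd k \<and> \<not> e dvd l)"
    and "\<not> 2 dvd k \<or> 2 dvd l \<or> d \<le> 4"
  shows "(\<lambda>n. real (ex_copies n (directed_cycle k) (directed_cycle l))
              - real n / real k * (real n / real d) ^ (k - 1))
         \<in> o(\<lambda>n. real n ^ k)"
proof (rule landau_o.smallI)
  fix c :: real assume c: "c > 0"
  have kpos: "k > 0" using assms(1) by simp
  have lpos: "l > 0" using assms(3) by (auto intro: Nat.gr0I)
  \<comment> \<open>The least element exists because \<open>k\<close> itself qualifies.\<close>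
  have dprops: "d > 2 \<and> d dvd k \<and> \<not> d dvd l"
    unfolding assms(4) by (rule LeastI[of _ k]) (use assms in auto)
  have dmin: "d \<le> e" if "e > 2" "e dvd k" "\<not> e dvd l" for e
    unfolding assms(4) by (rule Least_le) (use that in auto)
  have par: "d \<le> 4" if "2 dvd k" "\<not> 2 dvd l" using assms(5) that by blast
  \<comment> \<open>The sample size is fixed first, so that \<open>k^2 / m\<close> is at most
    \<open>c / 2\<close>; then \<open>\<eta>\<close> is chosen so that the bad samples cost exactly
    \<open>c / 2\<close>. Only afterwards does \<open>n\<close> grow.\<close>
  define m where "m = nat \<lceil>2 * real k^2 / c\<rceil> + 1"
  define \<eta> where "\<eta> = c / (2 * real m ^ l)"
  have m: "m > 0" by (simp add: m_def)
  have \<eta>: "\<eta> > 0" using c m by (simp add: \<eta>_def)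
  have m_bound: "real k^2 / real m \<le> c / 2"
  proof -
    have "2 * real k^2 / c \<le> real m" unfolding m_def by linarith
    then show ?thesis using c m by (simp add: field_simps)
  qed
  have \<eta>_bound: "real m ^ l * \<eta> = c / 2" using m by (simp add: \<eta>_def)
  \<comment> \<open>The first threshold makes the non-injective closed walks of length
    \<open>l\<close> sparse enough for \<open>\<eta>\<close>, the second absorbs the lower-order
    loss of the blow-up into \<open>c * n ^ k\<close>, and the third is the \<open>n \<ge> d\<close>
    of the lower bound.\<close>
  have "eventually (\<lambda>n. real n \<ge> real l^2 / \<eta> ^ (2 ^ l)) sequentially"
    "eventually (\<lambda>n. real n \<ge> real (d + k) / c) sequentially"
    "eventually (\<lambda>n. n \<ge> d) sequentially"
    using filterlim_real_sequentially by (auto simp: filterlim_at_top eventually_ge_at_top)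
  then show "eventually (\<lambda>n. norm (real (ex_copies n (directed_cycle k) (directed_cycle l))
              - real n / real k * (real n / real d) ^ (k - 1)) \<le> c * norm (real n ^ k)) sequentially"
  proof eventually_elim
    case (elim n)
    have npos: "n > 0" using elim(3) dprops by simp
    have main: "real n / real k * (real n / real d) ^ (k - 1) = real n ^ k / real d ^ (k - 1) / real k"
      using kpos by (cases k) (auto simp: power_divide)
    define ex where "ex = ex_copies n (directed_cycle k) (directed_cycle l)"
    have "ex \<in> copy_counts n (directed_cycle k) (directed_cycle l)"
      unfolding ex_def ex_copies_def by (rule Max_in[OF finite_copy_counts copy_counts_nonempty[OF lpos]])
    then obtain G :: "nat pair_pre_digraph" where G: "oriented_graph G" "card (pverts G) = n"
      "copies (directed_cycle l) G = {}" "ex = card (copies (directed_cycle k) G)"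
      by (auto simp: copy_counts_def)
    have "real l^2 / real n \<le> \<eta> ^ (2 ^ l)" using elim(1) npos \<eta> by (simp add: field_simps)
    then have "real k * real ex \<le> real n ^ k * (1 / real d ^ (k - 1) + real m ^ l * \<eta> + real k^2 / real m)"
      unfolding G(4) using dprops
      by (intro card_copies_directed_cycle_le[OF G(1,2) npos G(3) assms(1,2) _ dmin par m \<eta>]) auto
    also have "\<dots> \<le> real n ^ k * (1 / real d ^ (k - 1) + c)"
    proof (rule mult_left_mono)
      show "1 / real d ^ (k - 1) + real m ^ l * \<eta> + real k^2 / real m \<le> 1 / real d ^ (k - 1) + c"
        using m_bound \<eta>_bound by linarith
    qed simp
    finally have "real ex \<le> (real n ^ k / real d ^ (k - 1) + real n ^ k * c) / real k"
      using kpos by (simp add: field_simps)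
    also have "\<dots> \<le> real n ^ k / real d ^ (k - 1) / real k + c * real n ^ k"
    proof -
      have "real n ^ k * c / real k \<le> real n ^ k * c / 1"
        using c kpos by (intro divide_left_mono) auto
      then show ?thesis by (simp add: add_divide_distrib mult.commute)
    qed
    finally have upper: "real ex \<le> real n ^ k / real d ^ (k - 1) / real k + c * real n ^ k" .
    have "card (copies (directed_cycle k) (cycle_blowup d n)) \<in> copy_counts n (directed_cycle k) (directed_cycle l)"
      unfolding copy_counts_def
      using oriented_graph_cycle_blowup[of d n] copies_cycle_blowup[of d l n] dprops lpos
      by (intro CollectI exI[of _ "cycle_blowup d n"]) (auto simp: cycle_blowup_def)
    then have "card (copies (directed_cycle k) (cycle_blowup d n)) \<le> ex"
      unfolding ex_def ex_copies_def by (rule Max_ge[OF finite_copy_counts])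
    then have "real k * real (card (copies (directed_cycle k) (cycle_blowup d n))) \<le> real k * real ex"
      by (intro mult_left_mono) auto
    with card_copies_cycle_blowup_ge[of d k n] dprops kpos elim(3)
    have "real n ^ k / real d ^ (k - 1) - real (k * d + k^2) * real n ^ (k - 1) \<le> real k * real ex"
      by linarith
    moreover have "real (k * d + k^2) * real n ^ (k - 1) \<le> real k * (c * real n ^ k)"
    proof -
      have "real (d + k) \<le> c * real n" using elim(2) c by (simp add: field_simps)
      then have "real k * (real (d + k) * real n ^ (k - 1)) \<le> real k * (c * real n * real n ^ (k - 1))"
        by (intro mult_left_mono mult_right_mono) auto
      moreover have "real n * real n ^ (k - 1) = real n ^ k" using kpos by (cases k) auto
      ultimately show ?thesis by (simp add: algebra_simps power2_eq_square)
    qed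
    ultimately have "real n ^ k / real d ^ (k - 1) \<le> real k * (real ex + c * real n ^ k)"
      by (simp add: distrib_left)
    then have lower: "real n ^ k / real d ^ (k - 1) / real k \<le> real ex + c * real n ^ k"
      by (subst pos_divide_le_eq) (use kpos in \<open>simp_all only: of_nat_0_less_iff mult.commute\<close>)
    show ?case
      unfolding main ex_def[symmetric] using upper lower by (simp add: abs_le_iff)
  qed
qed

end
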